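(* There exist an absolutely continuous (with respect to $m$) measure $\mu$ on $\mathbb{T}$ and a measurable function $w$ on $\mathbb{T}$ such that $0<\mu'<1$ and $0<w\le 1$ $m$-a.e., $\int_{\mathbb{T}}\log w\,dm>-\infty$, and $$\lim_{n\to\infty}\frac{e_n(w\mu)}{e_n(\mu)}=0 .$$
   Context: $\mathbb{T}$ is the unit circle, $m$ is the normalized Lebesgue measure on $\mathbb{T}$ ($m(\mathbb{T})=1$), and $\mu'=\frac{d\mu}{dm}$. For a finite positive Borel measure $\rho$ on $\mathbb{T}$ and an integer $n\ge 0$, $e_n(\rho)\ge 0$ is defined by $$e_n(\rho)^2=\min_{q_0,\dots,q_{n-1}\in\mathbb{C}}\int_{\mathbb{T}}\bigl|t^n+q_{n-1}t^{n-1}+\dots+q_1t+q_0\bigr|^2\,d\rho(t).$$ $w\mu$ denotes the measure with density $w$ with respect to $\mu$. *)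

theory Defs
  imports "HOL-Analysis.Analysis" "HOL-Probability.Probability"
begin

definition circle_borel :: "complex measure" where
  "circle_borel = restrict_space borel (sphere 0 1)"

definition circle_lebesgue :: "complex measure" where
  "circle_lebesgue = distr (uniform_measure lborel {0..<2 * pi}) circle_borel cis"

text \<open>For a finite Borel measure on the circle the infimum below is a minimum: it is the squared
  distance in \<open>L\<^sup>2(\<rho>)\<close> from \<open>t ^ n\<close> to a finite-dimensional subspace.\<close>

definition min_monic_norm :: "nat \<Rightarrow> complex measure \<Rightarrow> real" where
  "min_monic_norm n \<rho> =
     sqrt (INF q :: nat \<Rightarrow> complex. LINT t|\<rho>. (cmod (t ^ n + (\<Sum>k<n. q k * t ^ k)))\<^sup>2)"

lemma cis_measurable_circle: "cis \<in> lborel \<rightarrow>\<^sub>M circle_borel"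
  unfolding circle_borel_def
  by (rule measurable_restrict_space2)
     (auto intro!: borel_measurable_continuous_onI continuous_intros simp: cis_conv_exp)

lemma space_circle_lebesgue: "space circle_lebesgue = sphere 0 1"
  by (simp add: circle_lebesgue_def circle_borel_def space_restrict_space)

lemma sets_circle_lebesgue: "sets circle_lebesgue = sets circle_borel"
  by (simp add: circle_lebesgue_def)

lemma prob_space_circle_lebesgue: "prob_space circle_lebesgue"
proof -
  have "prob_space (uniform_measure lborel {0..<2 * pi})"
    by (rule prob_space_uniform_measure) (auto simp: ennreal_zero_less_mult_iff)
  moreover have "cis \<in> uniform_measure lborel {0..<2 * pi} \<rightarrow>\<^sub>M circle_borel"
    using cis_measurable_circle by (simp cong: measurable_cong_sets)
  ultimately show ?thesis
    unfolding circle_lebesgue_def by (rule prob_space.prob_space_distr)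
qed

end

theory Submission
  imports Defs "HOL-Complex_Analysis.Complex_Analysis" "HOL-Real_Asymp.Real_Asymp"
begin

text \<open>
  In the coordinate \<open>x = \<i>(t + 1)/(t - 1)\<close> the circle is the real line, the point \<open>t = 1\<close> is
  \<open>x = \<infinity>\<close>, and for real \<open>b\<close> the half-line \<open>x \<le> b\<close> is an arc whose gap \<open>x > b\<close> has the fixed
  endpoint \<open>t = 1\<close>. Let \<open>u\<^sub>b\<close> map the complement of this arc conformally onto the disc, with
  \<open>t = \<infinity>\<close> going to \<open>0\<close>; then \<open>-log \<bar>u\<^sub>b\<bar>\<close> is Green's function of the arc and vanishes on the arc.
  Take \<open>\<mu>' = 1/2 \<Prod>\<^sub>j \<bar>u\<^sub>j\<bar>\<^bsup>4 h j\<^esup>\<close>, where \<open>u\<^sub>j\<close> belongs to \<open>b\<^sub>j\<close>, with \<open>b\<^sub>j \<rightarrow> \<infinity>\<close> slowly and \<open>h j\<close> growing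
  very fast. For \<open>n\<close> between \<open>\<Sum>\<^sub>i\<^sub><\<^sub>j 2 h i\<close> and \<open>\<Sum>\<^sub>i\<^sub>\<le>\<^sub>j 2 h i\<close> the size of \<open>e\<^sub>n(\<mu>)\<close> is, up to a factor
  that does not depend on \<open>h\<close>, the product of the powers \<open>2 h i\<close> of the capacities of the arcs \<open>i < j\<close>
  and the power \<open>n - \<Sum>\<^sub>i\<^sub><\<^sub>j 2 h i\<close> of the capacity of the \<open>j\<close>-th arc.

  The weight is \<open>w = exp(- (1 + x\<^sup>2)\<^bsup>3/8\<^esup>)\<close>. It is so small near \<open>t = 1\<close> that it absorbs the
  exponential of any multiple of the Martin function of the slit domain with pole at \<open>t = 1\<close>, which is
  of order \<open>\<bar>x\<bar>\<^bsup>1/2\<^esup>\<close> there. Multiplying a near-optimal polynomial by such an exponential gains an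
  arbitrarily large factor on the arc, at the price of growth inside the gap, which the factors of \<open>\<mu>'\<close>
  with larger \<open>b\<close> compensate. All gaps share the endpoint \<open>t = 1\<close>, and \<open>b\<^sub>j\<^sub>+\<^sub>1 - b\<^sub>j\<close> may be chosen
  independently of the gain wanted, so the gaps can shrink to a point.
\<close>

section \<open>Slit maps\<close>

text \<open>The value of the square root \<open>csqrt (x - b)\<close> at \<open>x = \<i>\<close>,
  the point that corresponds to \<open>t = \<infinity>\<close>.\<close>

definition gam :: "real \<Rightarrow> complex" where
  "gam b = csqrt (\<i> - of_real b)"

text \<open>Division by zero makes \<open>cayley 1 = 0\<close> rather than infinity; hence the
  condition \<open>t \<noteq> 1\<close> in the pointwise statements on the circle.\<close>

definition cayley :: "complex \<Rightarrow> complex" where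
  "cayley t = \<i> * (t + 1) / (t - 1)"

text \<open>For \<open>Re g > 0\<close> this is the Moebius map of the right half-plane onto the
  unit disc that sends \<open>g\<close> to \<open>0\<close> and infinity to
  \<open>1\<close>.\<close>

definition moeb :: "complex \<Rightarrow> complex \<Rightarrow> complex" where
  "moeb g G = (G - g) / (G + cnj g)"

text \<open>The conformal map of the slit domain \<open>x \<notin> (-\<infinity>, b]\<close> onto the unit disc sending \<open>\<i>\<close>
  (the image of \<open>t = \<infinity>\<close>) to \<open>0\<close>.\<close>

definition slitmap :: "real \<Rightarrow> complex \<Rightarrow> complex" where
  "slitmap b x = moeb (gam b) (csqrt (x - of_real b))"

text \<open>The logarithmic capacity of the arc \<open>x \<le> b\<close>.\<close>

definition arc_cap :: "real \<Rightarrow> real" where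
  "arc_cap b = 1 / (2 * cmod (gam b) * Re (gam b))"

lemma gam_sq: "(gam b)\<^sup>2 = \<i> - of_real b"
  by (simp add: gam_def)

lemma Re_Im_gam: "2 * Re (gam b) * Im (gam b) = 1"
  using arg_cong[OF gam_sq[of b], of Im] by (simp add: power2_eq_square mult_ac)

lemma Re_sq_gam: "(Re (gam b))\<^sup>2 - (Im (gam b))\<^sup>2 = - b"
  using arg_cong[OF gam_sq[of b], of Re] by (simp add: power2_eq_square)

lemma Re_gam_pos: "0 < Re (gam b)"
proof -
  have "0 \<le> Re (gam b)" unfolding gam_def by (rule Re_csqrt)
  moreover have "Re (gam b) \<noteq> 0" using Re_Im_gam[of b] by auto
  ultimately show ?thesis by simp
qed

lemma Im_gam_pos: "0 < Im (gam b)"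
  using Re_Im_gam[of b] Re_gam_pos[of b]
  by (metis mult_pos_pos pos_less_divide_eq zero_less_mult_pos zero_less_numeral zero_less_one)

lemma gam_nz: "gam b \<noteq> 0"
  using Re_gam_pos[of b] by auto

lemma arc_cap_pos: "0 < arc_cap b"
  unfolding arc_cap_def using Re_gam_pos[of b] gam_nz[of b] by simp

lemma arc_cap_le_1: "arc_cap b \<le> 1"
proof -
  have "1 = 2 * Re (gam b) * Im (gam b)" using Re_Im_gam by simp
  also have "\<dots> \<le> 2 * Re (gam b) * cmod (gam b)"
    using Re_gam_pos[of b] abs_Im_le_cmod[of "gam b"] by (intro mult_left_mono) auto
  finally show ?thesis unfolding arc_cap_def by (simp add: divide_le_eq_1 mult_ac)
qed

text \<open>The sign of the right-hand side tells on which side of the imaginary axis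
  \<open>G\<close> lies; the bounds for \<open>moeb\<close> in the half-plane, on its boundary and,
  quantitatively, on the gap all come from this identity.\<close>

lemma cmod_moeb_diff:
  "(cmod (G + cnj g))\<^sup>2 - (cmod (G - g))\<^sup>2 = 4 * Re G * Re g"
  unfolding cmod_power2 by (simp add: power2_eq_square algebra_simps)

lemma moeb_denom_nz: "Re g > 0 \<Longrightarrow> Re G \<ge> 0 \<Longrightarrow> G + cnj g \<noteq> 0"
  by (metis add_nonneg_pos cnj.sel(1) less_irrefl plus_complex.sel(1) zero_complex.sel(1))

lemma cmod_moeb_sq:
  assumes "Re g > 0" "Re G \<ge> 0"
  shows "(cmod (moeb g G))\<^sup>2 = 1 - 4 * Re G * Re g / (cmod (G + cnj g))\<^sup>2"
proof -
  have "(cmod (G + cnj g))\<^sup>2 \<noteq> 0" using moeb_denom_nz[OF assms] by simp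
  moreover have "(cmod (G - g))\<^sup>2 = (cmod (G + cnj g))\<^sup>2 - 4 * Re G * Re g"
    using cmod_moeb_diff[of G g] by simp
  ultimately show ?thesis
    unfolding moeb_def norm_divide power_divide by (simp add: divide_simps)
qed

lemma cmod_moeb_le_1:
  assumes "Re g > 0" "Re G \<ge> 0"
  shows "cmod (moeb g G) \<le> 1"
proof -
  have "(cmod (moeb g G))\<^sup>2 \<le> 1\<^sup>2"
    unfolding cmod_moeb_sq[OF assms] using assms by simp
  then show ?thesis by (rule power2_le_imp_le) simp
qed

lemma cmod_moeb_eq_1:
  assumes "Re g > 0" "Re G = 0"
  shows "cmod (moeb g G) = 1"
proof -
  have "(cmod (moeb g G))\<^sup>2 = 1\<^sup>2"
    using cmod_moeb_sq[of g G] assms by simp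
  then show ?thesis by (simp add: power2_eq_1_iff) (smt (verit) norm_ge_zero)
qed

lemma cmod_slitmap_le_1: "cmod (slitmap b x) \<le> 1"
  unfolding slitmap_def by (rule cmod_moeb_le_1) (auto simp: Re_gam_pos Re_csqrt simp del: csqrt.sel)

lemma csqrt_real_neg: "x \<le> b \<Longrightarrow> csqrt (of_real x - of_real b) = \<i> * of_real (sqrt (b - x))"
  for x b :: real
  by (subst of_real_diff[symmetric], subst csqrt_of_real') auto

lemma csqrt_real_pos: "x \<ge> b \<Longrightarrow> csqrt (of_real x - of_real b) = of_real (sqrt (x - b))"
  for x b :: real
  by (subst of_real_diff[symmetric], subst csqrt_of_real') auto

lemma cmod_slitmap_eq_1: "x \<le> b \<Longrightarrow> cmod (slitmap b (of_real x)) = 1"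
  unfolding slitmap_def by (rule cmod_moeb_eq_1) (auto simp: Re_gam_pos csqrt_real_neg)

text \<open>On the circle \<open>cnj t = 1 / t\<close>, and this substitution makes
  \<open>cayley t\<close> equal to its own conjugate.\<close>

lemma cayley_real:
  assumes "cmod t = 1" "t \<noteq> 1"
  shows "cayley t = of_real (Re (cayley t))"
proof -
  have t: "t * cnj t = 1" using assms by (simp add: complex_norm_square[symmetric])
  have t0: "t \<noteq> 0" using assms by auto
  have ct: "cnj t = 1 / t" using t t0 by (simp add: field_simps)
  have "cnj (cayley t) = cayley t"
    using t0 assms(2) unfolding cayley_def by (simp add: ct field_simps)
  then show ?thesis by (metis Reals_cnj_iff of_real_Re)
qed

lemma cayley_div:
  assumes "t \<noteq> 1"
  shows "(cayley t + \<i>) / (cayley t - \<i>) = t"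
  using assms unfolding cayley_def by (simp add: field_simps)

section \<open>Mean values on the circle\<close>

text \<open>\<open>csqrt\<close> jumps across the negative real axis, this function is continuous on
  the whole plane. It agrees with \<open>csqrt\<close> on the closed upper half-plane and with its
  conjugate below, so one-sided limits of \<open>csqrt\<close> become ordinary limits of
  \<open>csqrt_up\<close>.\<close>

definition csqrt_up :: "complex \<Rightarrow> complex" where
  "csqrt_up z = Complex (sqrt ((cmod z + Re z) / 2)) (sqrt ((cmod z - Re z) / 2))"

lemma csqrt_eq_up: "0 \<le> Im z \<Longrightarrow> csqrt z = csqrt_up z"
  by (rule complex_eqI) (auto simp: csqrt_up_def sgn_if)

lemma csqrt_eq_cnj_up: "Im z < 0 \<Longrightarrow> csqrt z = cnj (csqrt_up z)"
  by (rule complex_eqI) (auto simp: csqrt_up_def sgn_if)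

lemma tendsto_csqrt_up: "(f \<longlongrightarrow> z) F \<Longrightarrow> ((\<lambda>x. csqrt_up (f x)) \<longlongrightarrow> csqrt_up z) F"
  unfolding csqrt_up_def by (intro tendsto_Complex tendsto_intros) auto

section \<open>Measurability and integrals over the circle\<close>

lemma csqrt_measurable [measurable]: "csqrt \<in> borel_measurable borel"
  unfolding borel_measurable_complex_iff csqrt.simps sgn_if by measurable

lemma slitmap_measurable [measurable]: "slitmap b \<in> borel_measurable borel"
  unfolding slitmap_def[abs_def] moeb_def by measurable

lemma cayley_measurable [measurable]: "cayley \<in> borel_measurable borel"
  unfolding cayley_def[abs_def] by measurable

lemma borel_imp_circle:
  "f \<in> borel_measurable borel \<Longrightarrow> f \<in> borel_measurable circle_borel"
  unfolding circle_borel_def by (rule measurable_restrict_space1)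

lemma sets_circle_cong: "f \<in> borel_measurable circle_lebesgue \<longleftrightarrow> f \<in> borel_measurable circle_borel"
  by (rule arg_cong2[where f="(\<in>)"]) (rule refl, rule measurable_cong_sets[OF sets_circle_lebesgue refl])

lemma borel_imp_circle_lebesgue:
  "f \<in> borel_measurable borel \<Longrightarrow> f \<in> borel_measurable circle_lebesgue"
  unfolding sets_circle_cong by (rule borel_imp_circle)

lemma continuous_imp_circle_lebesgue:
  "continuous_on (sphere 0 1) f \<Longrightarrow> f \<in> borel_measurable circle_lebesgue"
  for f :: "complex \<Rightarrow> 'a::topological_space"
  unfolding sets_circle_cong circle_borel_def by (rule borel_measurable_continuous_on_restrict)

lemma uniform_eq_density:
  "uniform_measure lborel {0..<2 * pi} =
    density lborel (\<lambda>x. ennreal (indicator {0..<2 * pi} x / (2 * pi)))"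
proof -
  have "emeasure lborel {0..<2 * pi} = ennreal (2 * pi)" by simp
  moreover have "indicator {0..<2 * pi} x / ennreal (2 * pi) = ennreal (indicator {0..<2 * pi} x / (2 * pi))" for x
    by (subst divide_ennreal[symmetric]) (auto split: split_indicator)
  ultimately show ?thesis unfolding uniform_measure_def by simp
qed

lemma integral_circle:
  fixes g :: "complex \<Rightarrow> complex"
  assumes "continuous_on (sphere 0 1) g"
  shows "(LINT t|circle_lebesgue. g t) = integral {0..2 * pi} (\<lambda>\<theta>. g (cis \<theta>)) / (2 * pi)"
proof -
  have g: "g \<in> borel_measurable circle_borel"
    using continuous_imp_circle_lebesgue[OF assms] by (simp only: sets_circle_cong)
  have cont: "continuous_on UNIV (\<lambda>\<theta>. g (cis \<theta>))"
    by (rule continuous_on_compose2[OF assms]) (auto intro!: continuous_intros simp: cis_conv_exp)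
  then have m [measurable]: "(\<lambda>\<theta>. g (cis \<theta>)) \<in> borel_measurable borel"
    by (rule borel_measurable_continuous_onI)
  have "(LINT t|circle_lebesgue. g t) = (LINT \<theta>|uniform_measure lborel {0..<2 * pi}. g (cis \<theta>))"
    unfolding circle_lebesgue_def using cis_measurable_circle g
    by (intro integral_distr) (simp cong: measurable_cong_sets)
  also have "\<dots> = (LINT \<theta>|lborel. (indicator {0..<2 * pi} \<theta> / (2 * pi)) *\<^sub>R g (cis \<theta>))"
    unfolding uniform_eq_density by (rule integral_density) auto
  \<comment> \<open>The half-open interval differs from the compact one only by the null set
    \<open>{2 * pi}\<close>.\<close>
  also have "\<dots> = (LINT \<theta>|lborel. (1 / (2 * pi)) *\<^sub>R (indicator {0..2 * pi} \<theta> *\<^sub>R g (cis \<theta>)))"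
    by (rule integral_cong_AE) (auto intro!: AE_I[where N="{2 * pi}"] split: split_indicator)
  also have "\<dots> = (1 / (2 * pi)) *\<^sub>R (LINT \<theta>:{0..2 * pi}|lborel. g (cis \<theta>))"
    unfolding set_lebesgue_integral_def by (rule integral_scaleR_right)
  also have "(LINT \<theta>:{0..2 * pi}|lborel. g (cis \<theta>)) = integral {0..2 * pi} (\<lambda>\<theta>. g (cis \<theta>))"
  proof (rule set_borel_integral_eq_integral)
    show "set_integrable lborel {0..2 * pi} (\<lambda>\<theta>. g (cis \<theta>))"
      unfolding set_integrable_def
      by (rule borel_integrable_compact) (auto intro: continuous_on_subset[OF cont])
  qed
  finally show ?thesis by (simp add: scaleR_conv_of_real)
qed

text \<open>Cauchy's formula at the centre: on a circle about \<open>0\<close> one has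
  \<open>du / u = \<i> d\<theta>\<close>, so the contour integral is a mean.\<close>

lemma circle_mean_value:
  assumes F: "F holomorphic_on ball 0 1" and r: "0 < r" "r < 1"
  shows "(LINT t|circle_lebesgue. F (of_real r * t)) = F 0"
proof -
  have i2: "- (\<i> * 2 * complex_of_real pi * \<i> * F 0) = 2 * complex_of_real pi * F 0"
    by (simp add: algebra_simps)
  have sub: "cball 0 r \<subseteq> ball (0::complex) 1" using r by auto
  have "((\<lambda>u. F u / (u - 0)) has_contour_integral (2 * of_real pi * \<i> * F 0)) (circlepath 0 r)"
  proof (rule Cauchy_integral_circlepath)
    show "continuous_on (cball 0 r) F"
      using F sub holomorphic_on_imp_continuous_on holomorphic_on_subset by blast
    show "F holomorphic_on ball 0 r"
      using F r by (rule_tac holomorphic_on_subset[OF F]) auto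
    show "norm (0 - 0) < r" using r by simp
  qed
  then have "((\<lambda>t. F (of_real r * cis t) / (of_real r * cis t) * of_real r * \<i> * cis t)
      has_integral (2 * of_real pi * \<i> * F 0)) {0..2 * pi}"
    unfolding circlepath_def by (subst (asm) has_contour_integral_part_circlepath_iff) auto
  also have "(\<lambda>t. F (of_real r * cis t) / (of_real r * cis t) * of_real r * \<i> * cis t)
      = (\<lambda>t. \<i> * F (of_real r * cis t))"
    using r by (auto simp: field_simps)
  finally have "((\<lambda>t. - \<i> * (\<i> * F (of_real r * cis t)))
      has_integral (- \<i> * (2 * of_real pi * \<i> * F 0))) {0..2 * pi}"
    by (rule has_integral_mult_right)
  then have "integral {0..2 * pi} (\<lambda>t. F (of_real r * cis t)) = 2 * of_real pi * F 0"
    using i2 by (auto intro!: integral_unique simp: mult.assoc[symmetric])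
  moreover have "continuous_on (sphere 0 1) (\<lambda>t. F (of_real r * t))"
    using holomorphic_on_imp_continuous_on[OF F]
    by (rule continuous_on_compose2) (use r in \<open>auto intro!: continuous_intros simp: norm_mult\<close>)
  ultimately show ?thesis using integral_circle[of "\<lambda>t. F (of_real r * t)"] by simp
qed

text \<open>The mean value property of \<open>cnj \<circ> F \<circ> cnj\<close>. This form serves
  for the exterior of the circle: for \<open>t\<close> on the circle,
  \<open>1 / (r * cnj t) = t / r\<close> lies just outside.\<close>

lemma circle_mean_value_cnj:
  assumes F: "F holomorphic_on ball 0 1" and r: "0 < r" "r < 1"
  shows "(LINT t|circle_lebesgue. F (of_real r * cnj t)) = F 0"
proof -
  have "cnj ` ball 0 1 = ball 0 1"
    by (auto simp: image_cnj_conv_vimage_cnj)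
  then have "(cnj \<circ> F \<circ> cnj) holomorphic_on ball 0 1"
    using F by (intro holomorphic_on_compose_cnj_cnj) auto
  then have "(LINT t|circle_lebesgue. (cnj \<circ> F \<circ> cnj) (of_real r * t)) = (cnj \<circ> F \<circ> cnj) 0"
    using r by (rule circle_mean_value)
  then have "(LINT t|circle_lebesgue. cnj (F (of_real r * cnj t))) = cnj (F 0)"
    by (simp add: o_def)
  then show ?thesis by (simp del: complex_cnj_cancel_iff) (metis complex_cnj_cnj)
qed

lemma AE_circle_ne_1: "AE t in circle_lebesgue. t \<noteq> 1"
proof -
  have "AE \<theta> in lborel. \<theta> \<in> {0..<2 * pi} \<longrightarrow> cis \<theta> \<noteq> 1"
  proof (rule AE_I[where N="{0}"])
    show "{\<theta> \<in> space lborel. \<not> (\<theta> \<in> {0..<2 * pi} \<longrightarrow> cis \<theta> \<noteq> 1)} \<subseteq> {0}"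
    proof
      fix \<theta> :: real assume "\<theta> \<in> {\<theta> \<in> space lborel. \<not> (\<theta> \<in> {0..<2 * pi} \<longrightarrow> cis \<theta> \<noteq> 1)}"
      then have t: "0 \<le> \<theta>" "\<theta> < 2 * pi" "cis \<theta> = 1" by auto
      have "cos \<theta> = 1" using arg_cong[OF t(3), of Re] by simp
      then obtain k :: int where k: "\<theta> = of_int k * 2 * pi" using cos_one_2pi_int by auto
      have "0 \<le> of_int k * (2 * pi)" "of_int k * (2 * pi) < 1 * (2 * pi)" using t k by auto
      then have "0 \<le> (of_int k :: real)" "(of_int k :: real) < 1"
        using pi_gt_zero by (auto simp: zero_le_mult_iff mult_less_cancel_right)
      then have "k = 0" by linarith
      then show "\<theta> \<in> {0}" using k by simp
    qed
  qed auto
  then have "AE \<theta> in uniform_measure lborel {0..<2 * pi}. cis \<theta> \<noteq> 1"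
    by (subst AE_uniform_measure) auto
  moreover have "{x \<in> space circle_borel. x \<noteq> 1} \<in> sets circle_borel"
    unfolding circle_borel_def by (auto simp: sets_restrict_space space_restrict_space)
  ultimately show ?thesis
    unfolding circle_lebesgue_def using cis_measurable_circle
    by (subst AE_distr_iff) (simp_all cong: measurable_cong_sets)
qed

section \<open>The slit maps on the two sides of the circle\<close>

lemma Im_cayley: "Im (cayley v) = ((cmod v)\<^sup>2 - 1) / (cmod (v - 1))\<^sup>2"
proof -
  have "cayley v = \<i> * ((v + 1) / (v - 1))" by (simp add: cayley_def)
  then have "Im (cayley v) = Re ((v + 1) / (v - 1))" by (simp only: Im_i_times)
  also have "\<dots> = ((cmod v)\<^sup>2 - 1) / (cmod (v - 1))\<^sup>2"
    unfolding Re_divide cmod_power2 by (simp add: power2_eq_square algebra_simps)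
  finally show ?thesis .
qed

text \<open>The disc goes to the lower half-plane and, as
  \<open>cayley (1 / v) = - cayley v\<close>, its exterior to the upper one. The square roots at
  \<open>cayley v\<close> and \<open>- cayley v\<close> therefore avoid the branch cut.\<close>

lemma Im_cayley_neg: "cmod v < 1 \<Longrightarrow> Im (cayley v) < 0"
  unfolding Im_cayley by (intro divide_neg_pos) (auto simp: power_less_one_iff abs_square_less_1)

text \<open>Since \<open>- cayley v = cayley (1 / v)\<close>, this is the slit map at
  \<open>t = 1 / v\<close> with its simple zero at \<open>v = 0\<close> divided out in closed form,
  so that it is holomorphic at \<open>t = \<infinity>\<close> too.\<close>

definition outer_factor :: "real \<Rightarrow> complex \<Rightarrow> complex" where
  "outer_factor b v = 2 * \<i> /
     ((1 - v) * (csqrt (- cayley v - of_real b) + gam b) * (csqrt (- cayley v - of_real b) + cnj (gam b)))"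

lemma csqrt_plus_gam_nz: "csqrt z + gam b \<noteq> 0" "csqrt z + cnj (gam b) \<noteq> 0"
proof -
  have "Re (csqrt z + gam b) > 0" "Re (csqrt z + cnj (gam b)) > 0"
    using Re_csqrt[of z] Re_gam_pos[of b] by (simp_all del: csqrt.sel)
  then show "csqrt z + gam b \<noteq> 0" "csqrt z + cnj (gam b) \<noteq> 0" by force+
qed

text \<open>The zero is exposed by multiplying \<open>G - gam b\<close> with
  \<open>G + gam b\<close>: the product \<open>G\<^sup>2 - (gam b)\<^sup>2\<close> no longer
  contains the root and has the factor \<open>v\<close>.\<close>

lemma slitmap_eq_outer_factor:
  assumes "v \<noteq> 1"
  shows "slitmap b (- cayley v) = v * outer_factor b v"
proof -
  define G where "G = csqrt (- cayley v - of_real b)"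
  have nz: "G + gam b \<noteq> 0" "G + cnj (gam b) \<noteq> 0"
    unfolding G_def by (rule csqrt_plus_gam_nz)+
  have "(G - gam b) * (G + gam b) = G\<^sup>2 - (gam b)\<^sup>2"
    by (simp add: power2_eq_square algebra_simps)
  also have "\<dots> = - cayley v - \<i>" by (simp add: G_def gam_sq)
  also have "\<dots> = 2 * \<i> * v / (1 - v)"
    using assms by (simp add: cayley_def divide_simps) (simp add: algebra_simps)
  finally have e: "G - gam b = 2 * \<i> * v / (1 - v) / (G + gam b)"
    using nz(1) by (simp only: nonzero_eq_divide_eq[OF nz(1)])
  have "slitmap b (- cayley v) = (G - gam b) / (G + cnj (gam b))"
    by (simp add: slitmap_def moeb_def G_def)
  also have "\<dots> = v * outer_factor b v"
    unfolding outer_factor_def G_def[symmetric] e using nz assms by (simp add: divide_simps)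
  finally show ?thesis .
qed

text \<open>\<open>outer_factor b 0\<close> is the coefficient of \<open>1 / t\<close> in the
  expansion of the slit map at \<open>t = \<infinity>\<close>, whose modulus is the capacity of the
  arc.\<close>

lemma cmod_outer_factor_0: "cmod (outer_factor b 0) = arc_cap b"
proof -
  have "csqrt (- cayley 0 - of_real b) = gam b" by (simp add: cayley_def gam_def)
  then have "outer_factor b 0 = 2 * \<i> / ((2 * gam b) * (gam b + cnj (gam b)))"
    by (simp add: outer_factor_def)
  also have "gam b + cnj (gam b) = of_real (2 * Re (gam b))" by (simp add: complex_add_cnj)
  finally show ?thesis using Re_gam_pos[of b]
    by (simp add: arc_cap_def norm_mult norm_divide)
qed

lemma cayley_minus_nonpos: "cmod v < 1 \<Longrightarrow> - cayley v - of_real b \<notin> \<real>\<^sub>\<le>\<^sub>0" "cmod v < 1 \<Longrightarrow> cayley v - of_real b \<notin> \<real>\<^sub>\<le>\<^sub>0"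
  using Im_cayley_neg[of v] by (auto simp: complex_nonpos_Reals_iff)

lemma cayley_holomorphic: "cayley holomorphic_on ball 0 1"
  unfolding cayley_def[abs_def] by (intro holomorphic_intros) auto

lemma outer_factor_holomorphic: "outer_factor b holomorphic_on ball 0 1"
  unfolding outer_factor_def[abs_def]
  by (intro holomorphic_intros cayley_holomorphic)
     (auto simp: csqrt_plus_gam_nz cayley_minus_nonpos)

lemma slitmap_cayley_holomorphic: "(\<lambda>v. slitmap b (cayley v)) holomorphic_on ball 0 1"
  unfolding slitmap_def[abs_def] moeb_def
  by (intro holomorphic_intros cayley_holomorphic)
     (auto simp: csqrt_plus_gam_nz cayley_minus_nonpos)

lemma cayley_cnj:
  assumes "cmod t = 1" "t \<noteq> 1"
  shows "- cayley (cnj t) = cayley t"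
proof -
  have t: "t * cnj t = 1" using assms by (simp add: complex_norm_square[symmetric])
  have t0: "t \<noteq> 0" using assms by auto
  have ct: "cnj t = 1 / t" using t t0 by (simp add: field_simps)
  have "1 / t \<noteq> 1" using assms t0 by (simp add: field_simps)
  then show ?thesis using t0 assms(2) unfolding cayley_def ct by (simp add: divide_simps) (simp add: algebra_simps)
qed

lemma tendsto_cayley:
  "(f \<longlongrightarrow> z) F \<Longrightarrow> z \<noteq> 1 \<Longrightarrow> ((\<lambda>k. cayley (f k)) \<longlongrightarrow> cayley z) F"
  unfolding cayley_def by (intro tendsto_intros) auto

text \<open>Just outside the circle \<open>x\<close> approaches the real line from above, and the
  principal root is continuous up to its cut from that side.\<close>

lemma tendsto_slitmap_outside:
  assumes "v \<longlonglongrightarrow> cnj t" "\<And>k. cmod (v k) < 1" "cmod t = 1" "t \<noteq> 1"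
  shows "(\<lambda>k. slitmap b (- cayley (v k))) \<longlonglongrightarrow> slitmap b (cayley t)"
proof -
  have ne: "cnj t \<noteq> 1" using assms(4) by (metis complex_cnj_cnj complex_cnj_one)
  have "(\<lambda>k. csqrt_up (- cayley (v k) - of_real b)) \<longlonglongrightarrow> csqrt_up (- cayley (cnj t) - of_real b)"
    by (intro tendsto_csqrt_up tendsto_intros tendsto_cayley assms ne)
  moreover have "csqrt_up (- cayley (v k) - of_real b) = csqrt (- cayley (v k) - of_real b)" for k
    using Im_cayley_neg[OF assms(2), of k] by (intro csqrt_eq_up[symmetric]) simp
  moreover have "csqrt_up (- cayley (cnj t) - of_real b) = csqrt (cayley t - of_real b)"
    unfolding cayley_cnj[OF assms(3,4)] using cayley_real[OF assms(3,4)]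
    by (intro csqrt_eq_up[symmetric]) (metis Im_complex_of_real minus_complex.sel(2) diff_self order_refl)
  ultimately have "(\<lambda>k. csqrt (- cayley (v k) - of_real b)) \<longlonglongrightarrow> csqrt (cayley t - of_real b)" by simp
  then show ?thesis unfolding slitmap_def moeb_def
    by (intro tendsto_intros) (auto simp: csqrt_plus_gam_nz)
qed

text \<open>The boundary value from the lower half-plane, that is from inside the unit circle; there
  the root tends to the conjugate of the principal value.\<close>

definition slitmap_low :: "real \<Rightarrow> complex \<Rightarrow> complex" where
  "slitmap_low b x = moeb (gam b) (cnj (csqrt (x - of_real b)))"

lemma cnj_csqrt_plus_gam_nz: "cnj (csqrt z) + cnj (gam b) \<noteq> 0"
  using csqrt_plus_gam_nz(1)[of z b] by (metis complex_cnj_add complex_cnj_zero_iff)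

lemma tendsto_slitmap_inside:
  assumes "v \<longlonglongrightarrow> t" "\<And>k. cmod (v k) < 1" "cmod t = 1" "t \<noteq> 1"
  shows "(\<lambda>k. slitmap b (cayley (v k))) \<longlonglongrightarrow> slitmap_low b (cayley t)"
proof -
  have "(\<lambda>k. cnj (csqrt_up (cayley (v k) - of_real b))) \<longlonglongrightarrow> cnj (csqrt_up (cayley t - of_real b))"
    by (intro tendsto_cnj tendsto_csqrt_up tendsto_intros tendsto_cayley assms)
  moreover have "cnj (csqrt_up (cayley (v k) - of_real b)) = csqrt (cayley (v k) - of_real b)" for k
    using Im_cayley_neg[OF assms(2), of k] by (intro csqrt_eq_cnj_up[symmetric]) simp
  moreover have "csqrt_up (cayley t - of_real b) = csqrt (cayley t - of_real b)"
    using cayley_real[OF assms(3,4)]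
    by (intro csqrt_eq_up[symmetric]) (metis Im_complex_of_real minus_complex.sel(2) diff_self order_refl)
  ultimately have "(\<lambda>k. csqrt (cayley (v k) - of_real b)) \<longlonglongrightarrow> cnj (csqrt (cayley t - of_real b))" by simp
  then show ?thesis unfolding slitmap_def slitmap_low_def moeb_def
    by (intro tendsto_intros) (auto simp: cnj_csqrt_plus_gam_nz)
qed

text \<open>On the gap the root is real, so conjugation changes nothing and the slit map has no jump
  there.\<close>

lemma slitmap_low_eq:
  assumes "x > b" shows "slitmap_low b (of_real x) = slitmap b (of_real x)"
  using assms by (simp add: slitmap_low_def slitmap_def csqrt_real_pos)

lemma cmod_slitmap_low: "cmod (slitmap_low b (of_real x)) = cmod (slitmap b (of_real x))"
proof (cases "x > b")
  case True then show ?thesis by (simp add: slitmap_low_eq)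
next
  case False
  then have "cmod (slitmap_low b (of_real x)) = 1"
    unfolding slitmap_low_def by (intro cmod_moeb_eq_1) (auto simp: Re_gam_pos csqrt_real_neg)
  then show ?thesis using False by (simp add: cmod_slitmap_eq_1)
qed

lemma slitmap_low_measurable [measurable]: "slitmap_low b \<in> borel_measurable borel"
proof -
  have [measurable]: "cnj \<in> borel_measurable borel"
    by (intro borel_measurable_continuous_onI continuous_intros)
  show ?thesis unfolding slitmap_low_def[abs_def] moeb_def by measurable
qed

section \<open>Lower bound\<close>

text \<open>The variance of \<open>g\<close> is nonnegative.\<close>

lemma integral_square_ge:
  assumes "prob_space M" and g: "g \<in> borel_measurable M" and B: "\<And>t. t \<in> space M \<Longrightarrow> \<bar>g t\<bar> \<le> (B::real)"
  shows "(LINT t|M. g t)\<^sup>2 \<le> (LINT t|M. (g t)\<^sup>2)"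
proof -
  interpret prob_space M by fact
  note [measurable] = g
  have i1: "integrable M g"
    by (rule integrable_const_bound[where B=B]) (use B in auto)
  have i2: "integrable M (\<lambda>t. (g t)\<^sup>2)"
  proof (rule integrable_const_bound[where B="B\<^sup>2"])
    show "AE t in M. norm ((g t)\<^sup>2) \<le> B\<^sup>2"
    proof (rule AE_I2)
      fix t assume "t \<in> space M"
      then have "\<bar>g t\<bar>\<^sup>2 \<le> B\<^sup>2" by (intro power_mono B) auto
      then show "norm ((g t)\<^sup>2) \<le> B\<^sup>2" by simp
    qed
  qed measurable
  define m where "m = (LINT t|M. g t)"
  have "0 \<le> (LINT t|M. (g t - m)\<^sup>2)" by (rule integral_nonneg_AE) auto
  also have "\<dots> = (LINT t|M. (g t)\<^sup>2 - 2 * m * g t + m\<^sup>2)"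
    by (intro Bochner_Integration.integral_cong refl) (simp add: power2_eq_square algebra_simps)
  also have "\<dots> = (LINT t|M. (g t)\<^sup>2) - 2 * m * m + m\<^sup>2"
    using i1 i2 by (simp add: m_def prob_space)
  finally show ?thesis by (simp add: m_def power2_eq_square)
qed

text \<open>The function \<open>P(t) \<Prod>\<^sub>i u\<^sub>i\<^bsup>l i\<^esup> u\<^sub>c t\<close> is holomorphic off the arc, including \<open>t = \<infinity>\<close>, and vanishes
  at \<open>t = 0\<close>. Its value at infinity is therefore the difference of its means over circles slightly larger
  and slightly smaller than the unit circle. In the limit the two boundary values cancel on the gap, and only
  the integral over the arc remains.\<close>

lemma outer_value_le_integral:
  fixes l :: "nat \<Rightarrow> nat" and b :: "nat \<Rightarrow> real" and q :: "nat \<Rightarrow> complex"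
  assumes fin: "finite I" and n: "n = sum l I" and bc: "\<And>i. i \<in> I \<Longrightarrow> b i \<le> c"
  defines "P \<equiv> \<lambda>t. t ^ n + (\<Sum>k<n. q k * t ^ k)"
  shows "(\<Prod>i\<in>I. arc_cap (b i) ^ l i) * arc_cap c \<le>
    (LINT t|circle_lebesgue. (if Re (cayley t) \<le> c
       then 2 * (cmod (P t) * (\<Prod>i\<in>I. cmod (slitmap (b i) (cayley t)) ^ l i)) else 0))"
proof -
  interpret prob_space circle_lebesgue by (rule prob_space_circle_lebesgue)
  \<comment> \<open>For \<open>v \<noteq> 0\<close>, \<open>Ps v = v ^ n * P (1 / v)\<close>. The
    function described above is \<open>Q\<close> outside the circle, in the variable
    \<open>v = 1 / t\<close>, and \<open>F\<close> inside it; in \<open>Q\<close> all powers of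
    \<open>v\<close> cancel because \<open>n = sum l I\<close>.\<close>
  define Ps where "Ps v = 1 + (\<Sum>k<n. q k * v ^ (n - k))" for v :: complex
  define Q where "Q v = Ps v * (\<Prod>i\<in>I. outer_factor (b i) v ^ l i) * outer_factor c v" for v
  define F where "F v = v * (P v * (\<Prod>i\<in>I. slitmap (b i) (cayley v) ^ l i) * slitmap c (cayley v))" for v
  define K where "K = 1 + (\<Sum>k<n. cmod (q k))"
  \<comment> \<open>The radii increase to \<open>1\<close> and stay at least \<open>1/2\<close>, so
    the division by \<open>v\<close> in \<open>outer_eq\<close> costs at most a factor
    \<open>2\<close> per slit map; this gives a bound uniform in \<open>k\<close> for dominated
    convergence.\<close>
  define r where "r k = 1 - 1 / (real k + 2)" for k :: nat
  define d where "d t = (if Re (cayley t) \<le> c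
       then 2 * (cmod (P t) * (\<Prod>i\<in>I. cmod (slitmap (b i) (cayley t)) ^ l i)) else 0)" for t
  define L where "L t = Ps (cnj t) * (\<Prod>i\<in>I. (slitmap (b i) (cayley t) / cnj t) ^ l i) * (slitmap c (cayley t) / cnj t)
     - t * (P t * (\<Prod>i\<in>I. slitmap_low (b i) (cayley t) ^ l i) * slitmap_low c (cayley t))" for t
  define s where "s k t = Q (of_real (r k) * cnj t) - F (of_real (r k) * t)" for k t
  have r: "1/2 \<le> r k" "0 < r k" "r k < 1" for k by (auto simp: r_def field_simps)
  have rlim: "r \<longlonglongrightarrow> 1"
  proof -
    have "(\<lambda>k. 1 - 1 / real (k + 2)) \<longlonglongrightarrow> 1 - 0"
      by (intro tendsto_diff tendsto_const LIMSEQ_ignore_initial_segment[OF lim_1_over_n])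
    then show ?thesis by (simp add: r_def[abs_def] ac_simps)
  qed
  have K1: "1 \<le> K" unfolding K_def by (simp add: sum_nonneg)
  have Pb: "cmod (P v) \<le> K" if "cmod v \<le> 1" for v
  proof -
    have "cmod (P v) \<le> cmod (v ^ n) + (\<Sum>k<n. cmod (q k * v ^ k))"
      unfolding P_def by (intro norm_triangle_le add_left_mono norm_sum)
    also have "\<dots> \<le> 1 + (\<Sum>k<n. cmod (q k))"
      using that by (intro add_mono sum_mono) (auto simp: norm_mult norm_power power_le_one mult_left_le)
    finally show ?thesis by (simp add: K_def)
  qed
  have Psb: "cmod (Ps v) \<le> K" if "cmod v \<le> 1" for v
  proof -
    have "cmod (Ps v) \<le> cmod 1 + (\<Sum>k<n. cmod (q k * v ^ (n - k)))"
      unfolding Ps_def by (intro norm_triangle_le add_left_mono norm_sum)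
    also have "\<dots> \<le> 1 + (\<Sum>k<n. cmod (q k))"
      using that by (intro add_mono sum_mono) (auto simp: norm_mult norm_power power_le_one mult_left_le)
    finally show ?thesis by (simp add: K_def)
  qed
  have hQ: "Q holomorphic_on ball 0 1"
    unfolding Q_def[abs_def] Ps_def
    by (intro holomorphic_intros outer_factor_holomorphic)
  have hF: "F holomorphic_on ball 0 1"
    unfolding F_def[abs_def] P_def
    by (intro holomorphic_intros slitmap_cayley_holomorphic)
  have slit_prod: "cmod (\<Prod>i\<in>I. slitmap (b i) x ^ l i) \<le> 1" for x
    unfolding prod_norm[symmetric] norm_power by (intro prod_le_1) (auto intro!: power_le_one cmod_slitmap_le_1)
  have Fb: "cmod (F v) \<le> K" if "cmod v \<le> 1" for v
  proof -
    have "cmod (F v) \<le> 1 * (K * 1 * 1)" unfolding F_def norm_mult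
      using that K1 by (intro mult_mono Pb slit_prod cmod_slitmap_le_1 mult_nonneg_nonneg) auto
    then show ?thesis by simp
  qed
  have outer_eq: "outer_factor a v = slitmap a (- cayley v) / v" if "v \<noteq> 0" "v \<noteq> 1" for a v
    using slitmap_eq_outer_factor[OF that(2), of a] that by simp
  have outer_b: "cmod (outer_factor a v) \<le> 2" if "1/2 \<le> cmod v" "cmod v < 1" for a v
  proof -
    have "cmod (outer_factor a v) = cmod (slitmap a (- cayley v)) / cmod v"
      using that by (subst outer_eq) (auto simp: norm_divide)
    also have "\<dots> \<le> 1 / (1/2)" using that by (intro frac_le cmod_slitmap_le_1) auto
    finally show ?thesis by simp
  qed
  have Qb: "cmod (Q v) \<le> K * 2 ^ n * 2" if "1/2 \<le> cmod v" "cmod v < 1" for v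
  proof -
    have "cmod (\<Prod>i\<in>I. outer_factor (b i) v ^ l i) \<le> (\<Prod>i\<in>I. 2 ^ l i)"
      unfolding prod_norm[symmetric] norm_power
      by (intro prod_mono conjI power_mono outer_b that) auto
    also have "\<dots> = 2 ^ n" unfolding n by (simp add: power_sum)
    finally show ?thesis unfolding Q_def norm_mult
      using that K1 by (intro mult_mono Psb outer_b mult_nonneg_nonneg) auto
  qed
  have sb: "cmod (s k t) \<le> K * 2 ^ n * 2 + K" if "cmod t = 1" for k t
  proof -
    have "cmod (s k t) \<le> cmod (Q (of_real (r k) * cnj t)) + cmod (F (of_real (r k) * t))"
      unfolding s_def by (rule norm_triangle_ineq4)
    also have "\<dots> \<le> K * 2 ^ n * 2 + K"
      using r[of k] that by (intro add_mono Qb Fb) (auto simp: norm_mult)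
    finally show ?thesis .
  qed
  have sp: "t \<in> space circle_lebesgue \<Longrightarrow> cmod t = 1" for t by (simp add: space_circle_lebesgue)
  have contQ: "continuous_on (sphere 0 1) (\<lambda>t. Q (of_real (r k) * cnj t))" for k
    using holomorphic_on_imp_continuous_on[OF hQ]
    by (rule continuous_on_compose2) (use r[of k] in \<open>auto intro!: continuous_intros simp: norm_mult\<close>)
  have contF: "continuous_on (sphere 0 1) (\<lambda>t. F (of_real (r k) * t))" for k
    using holomorphic_on_imp_continuous_on[OF hF]
    by (rule continuous_on_compose2) (use r[of k] in \<open>auto intro!: continuous_intros simp: norm_mult\<close>)
  have ms: "s k \<in> borel_measurable circle_lebesgue" for k
    unfolding s_def[abs_def] by (intro continuous_imp_circle_lebesgue continuous_intros contQ contF)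
  have int_s: "(LINT t|circle_lebesgue. s k t) = Q 0" for k
  proof -
    have "integrable circle_lebesgue (\<lambda>t. Q (of_real (r k) * cnj t))"
      by (rule integrable_const_bound[where B="K * 2 ^ n * 2"])
         (use r[of k] in \<open>auto intro!: AE_I2 Qb continuous_imp_circle_lebesgue contQ simp: norm_mult sp\<close>)
    moreover have "integrable circle_lebesgue (\<lambda>t. F (of_real (r k) * t))"
      by (rule integrable_const_bound[where B=K])
         (use r[of k] in \<open>auto intro!: AE_I2 Fb continuous_imp_circle_lebesgue contF simp: norm_mult sp\<close>)
    ultimately have "(LINT t|circle_lebesgue. s k t) = Q 0 - F 0"
      unfolding s_def using circle_mean_value_cnj[OF hQ r(2,3)] circle_mean_value[OF hF r(2,3)] by simp
    then show ?thesis by (simp add: F_def)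
  qed
  have lim: "(\<lambda>k. s k t) \<longlonglongrightarrow> L t" if t: "cmod t = 1" "t \<noteq> 1" for t
  proof -
    have v1: "(\<lambda>k. of_real (r k) * t) \<longlonglongrightarrow> t" "(\<lambda>k. of_real (r k) * cnj t) \<longlonglongrightarrow> cnj t"
      using tendsto_mult[OF tendsto_of_real[OF rlim] tendsto_const, of t]
            tendsto_mult[OF tendsto_of_real[OF rlim] tendsto_const, of "cnj t"] by simp_all
    have v2: "cmod (of_real (r k) * t) < 1" "cmod (of_real (r k) * cnj t) < 1" for k
      using r[of k] t by (auto simp: norm_mult)
    have nz: "cnj t \<noteq> 0" using t by auto
    have v3: "of_real (r k) * cnj t \<noteq> 0" "of_real (r k) * cnj t \<noteq> 1" for k
      using r[of k] nz v2(2)[of k] by (force)+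
    have "(\<lambda>k. Ps (of_real (r k) * cnj t) *
        (\<Prod>i\<in>I. (slitmap (b i) (- cayley (of_real (r k) * cnj t)) / (of_real (r k) * cnj t)) ^ l i) *
        (slitmap c (- cayley (of_real (r k) * cnj t)) / (of_real (r k) * cnj t))
       - of_real (r k) * t * (P (of_real (r k) * t) * (\<Prod>i\<in>I. slitmap (b i) (cayley (of_real (r k) * t)) ^ l i)
           * slitmap c (cayley (of_real (r k) * t)))) \<longlonglongrightarrow> L t"
      unfolding L_def P_def Ps_def
      by (intro tendsto_intros tendsto_slitmap_outside tendsto_slitmap_inside v1 v2 nz t)
    then show ?thesis unfolding s_def Q_def F_def outer_eq[OF v3] by simp
  qed
  have Ld: "cmod (L t) \<le> d t" if t: "cmod t = 1" "t \<noteq> 1" for t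
  proof -
    define x where "x = Re (cayley t)"
    have cx: "cayley t = of_real x" unfolding x_def by (rule cayley_real[OF t])
    have tt: "t * cnj t = 1" using t by (simp add: complex_norm_square[symmetric])
    have t0: "t \<noteq> 0" using t by auto
    have ct: "cnj t = 1 / t" using tt t0 by (simp add: field_simps)
    have PPs: "t ^ n * Ps (cnj t) = P t"
    proof -
      have "t ^ n * (q k * cnj t ^ (n - k)) = q k * t ^ k" if "k < n" for k
      proof -
        have "t ^ n = t ^ k * t ^ (n - k)" using that by (simp flip: power_add)
        then have "t ^ n * (q k * cnj t ^ (n - k)) = q k * t ^ k * (t * cnj t) ^ (n - k)"
          unfolding power_mult_distrib by (simp add: mult_ac)
        then show ?thesis by (simp add: tt)
      qed
      then have "(\<Sum>k<n. t ^ n * (q k * cnj t ^ (n - k))) = (\<Sum>k<n. q k * t ^ k)"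
        by (intro sum.cong) auto
      then show ?thesis unfolding Ps_def P_def by (simp add: distrib_left sum_distrib_left)
    qed
    \<comment> \<open>With \<open>1 / cnj t = t\<close> and \<open>n = sum l I\<close> the exterior
      term takes the form of the interior one, with \<open>slitmap\<close> in place of
      \<open>slitmap_low\<close>.\<close>
    have "Ps (cnj t) * (\<Prod>i\<in>I. (slitmap (b i) (cayley t) / cnj t) ^ l i) * (slitmap c (cayley t) / cnj t)
       = Ps (cnj t) * ((\<Prod>i\<in>I. slitmap (b i) (cayley t) ^ l i) * t ^ n) * (slitmap c (cayley t) * t)"
      unfolding ct n by (simp add: power_sum prod.distrib[symmetric] power_mult_distrib)
    also have "\<dots> = t * ((t ^ n * Ps (cnj t)) * (\<Prod>i\<in>I. slitmap (b i) (cayley t) ^ l i) * slitmap c (cayley t))"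
      by (simp add: mult_ac)
    finally have L2: "L t = t * (P t * (\<Prod>i\<in>I. slitmap (b i) (cayley t) ^ l i) * slitmap c (cayley t))
        - t * (P t * (\<Prod>i\<in>I. slitmap_low (b i) (cayley t) ^ l i) * slitmap_low c (cayley t))"
      unfolding L_def PPs by simp
    \<comment> \<open>For \<open>x > c\<close> the point lies in all the gaps, as
      \<open>b i \<le> c\<close>, and the two boundary values cancel. On the arc
      \<open>x \<le> c\<close> they are merely added in modulus, whence the factor \<open>2\<close>
      in \<open>d\<close>.\<close>
    show ?thesis
    proof (cases "x \<le> c")
      case False
      then have "slitmap_low c (cayley t) = slitmap c (cayley t)"
        "\<And>i. i \<in> I \<Longrightarrow> slitmap_low (b i) (cayley t) = slitmap (b i) (cayley t)"
        unfolding cx using bc by (auto intro!: slitmap_low_eq simp: not_le intro: le_less_trans)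
      then have "L t = 0" unfolding L2 by simp
      then show ?thesis using False by (simp add: d_def x_def)
    next
      case True
      define A where "A = cmod (P t) * (\<Prod>i\<in>I. cmod (slitmap (b i) (cayley t)) ^ l i)"
      have A0: "0 \<le> A" unfolding A_def by (intro mult_nonneg_nonneg prod_nonneg) auto
      have "cmod (L t) \<le> A * cmod (slitmap c (cayley t)) + A * cmod (slitmap c (cayley t))"
        unfolding L2 A_def
        by (rule order_trans[OF norm_triangle_ineq4])
           (simp add: norm_mult t prod_norm[symmetric] norm_power cx cmod_slitmap_low)
      also have "\<dots> \<le> A * 1 + A * 1"
        by (intro add_mono mult_left_mono cmod_slitmap_le_1 A0)
      finally show ?thesis using True by (simp add: d_def x_def A_def)
    qed
  qed
  have [measurable]: "cnj \<in> borel_measurable borel"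
    by (intro borel_measurable_continuous_onI continuous_intros)
  have mL: "L \<in> borel_measurable circle_lebesgue"
    unfolding L_def[abs_def] Ps_def P_def by (rule borel_imp_circle_lebesgue) measurable
  have md: "d \<in> borel_measurable circle_lebesgue"
    unfolding d_def[abs_def] P_def by (rule borel_imp_circle_lebesgue) measurable
  have AE1: "AE t in circle_lebesgue. cmod t = 1 \<and> t \<noteq> 1"
    using AE_circle_ne_1 AE_space by eventually_elim (simp add: sp)
  have AElim: "AE t in circle_lebesgue. (\<lambda>k. s k t) \<longlonglongrightarrow> L t"
    using AE1 by eventually_elim (use lim in auto)
  have AELd: "AE t in circle_lebesgue. cmod (L t) \<le> d t"
    using AE1 by eventually_elim (use Ld in auto)
  have AEsb: "AE t in circle_lebesgue. norm (s k t) \<le> K * 2 ^ n * 2 + K" for k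
    using AE1 by eventually_elim (use sb in auto)
  have dct: "(\<lambda>k. LINT t|circle_lebesgue. s k t) \<longlonglongrightarrow> (LINT t|circle_lebesgue. L t)"
    by (rule integral_dominated_convergence[where w="\<lambda>_. K * 2 ^ n * 2 + K"])
       (auto intro!: mL ms AElim AEsb simp del: norm_le_zero_iff)
  have iL: "integrable circle_lebesgue L"
    by (rule integrable_dominated_convergence[where w="\<lambda>_. K * 2 ^ n * 2 + K" and s=s])
       (auto intro!: mL ms AElim AEsb simp del: norm_le_zero_iff)
  have db: "\<bar>d t\<bar> \<le> 2 * K" if "cmod t = 1" for t
  proof -
    have "cmod (P t) * (\<Prod>i\<in>I. cmod (slitmap (b i) (cayley t)) ^ l i) \<le> K * 1"
      using slit_prod[of "cayley t"] that K1
      by (intro mult_mono Pb) (auto simp: prod_norm[symmetric] norm_power intro!: prod_nonneg)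
    moreover have "0 \<le> cmod (P t) * (\<Prod>i\<in>I. cmod (slitmap (b i) (cayley t)) ^ l i)"
      by (intro mult_nonneg_nonneg prod_nonneg) auto
    ultimately show ?thesis using K1 by (simp add: d_def)
  qed
  have id: "integrable circle_lebesgue d"
    by (rule integrable_const_bound[where B="2 * K"]) (auto intro!: AE_I2 db sp md)
  \<comment> \<open>The means are \<open>Q 0\<close> for every \<open>k\<close>, so the limit is
    \<open>Q 0\<close> as well.\<close>
  have "Q 0 = (LINT t|circle_lebesgue. L t)"
    using dct unfolding int_s by (simp add: LIMSEQ_const_iff)
  then have "cmod (Q 0) \<le> (LINT t|circle_lebesgue. cmod (L t))"
    using integral_norm_bound[of circle_lebesgue L] by simp
  also have "\<dots> \<le> (LINT t|circle_lebesgue. d t)"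
    by (rule integral_mono_AE) (use AELd iL id in \<open>auto\<close>)
  also have "cmod (Q 0) = (\<Prod>i\<in>I. arc_cap (b i) ^ l i) * arc_cap c"
  proof -
    have "Ps 0 = 1" by (simp add: Ps_def power_0_left)
    then show ?thesis by (simp add: Q_def norm_mult prod_norm[symmetric] norm_power cmod_outer_factor_0)
  qed
  finally show ?thesis by (simp add: d_def)
qed

section \<open>Faber polynomials of an arc\<close>

text \<open>The second branch of the algebraic function obtained by changing the sign of the square root;
  symmetric expressions in the two branches are polynomials in \<open>t\<close>.\<close>

definition dualmap :: "real \<Rightarrow> complex \<Rightarrow> complex" where
  "dualmap b x = moeb (gam b) (- csqrt (x - of_real b))"

lemma circle_cayley_ne:
  assumes "cmod t = 1" "t \<noteq> 1"
  shows "cayley t - \<i> \<noteq> 0" "cayley t + \<i> \<noteq> 0"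
proof -
  obtain x where x: "cayley t = of_real x" using cayley_real[OF assms] by blast
  show "cayley t - \<i> \<noteq> 0" "cayley t + \<i> \<noteq> 0" unfolding x by (auto simp: complex_eq_iff)
qed

text \<open>The reciprocals of the two branches are the roots of a quadratic equation whose
  coefficients are polynomials in \<open>t\<close>: their product is \<open>t\<close>, their sum is
  linear. Both follow because only \<open>G\<^sup>2 = x - b\<close> survives in symmetric
  expressions.\<close>

lemma slitmap_dualmap:
  assumes "cmod t = 1" "t \<noteq> 1"
  shows "slitmap b (cayley t) * dualmap b (cayley t) = 1 / t"
    and "slitmap b (cayley t) \<noteq> 0" and "dualmap b (cayley t) \<noteq> 0"
    and "1 / slitmap b (cayley t) + 1 / dualmap b (cayley t)
      = (- 2 * \<i> * Re (gam b)) * (gam b * t - cnj (gam b))"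
proof -
  define G where "G = csqrt (cayley t - of_real b)"
  define g where "g = gam b"
  have t0: "t \<noteq> 0" using assms by auto
  have g2: "g\<^sup>2 = \<i> - of_real b" unfolding g_def by (rule gam_sq)
  have cg2: "(cnj g)\<^sup>2 = - \<i> - of_real b"
    using arg_cong[OF g2, of cnj] by simp
  have G2: "G\<^sup>2 = cayley t - of_real b" by (simp add: G_def)
  have "(G - g) * (G + g) = G\<^sup>2 - g\<^sup>2" by (simp add: power2_eq_square algebra_simps)
  then have e1: "(G - g) * (G + g) = cayley t - \<i>" unfolding G2 g2 by simp
  have "(G + cnj g) * (G - cnj g) = G\<^sup>2 - (cnj g)\<^sup>2" by (simp add: power2_eq_square algebra_simps)
  then have e2: "(G + cnj g) * (G - cnj g) = cayley t + \<i>" unfolding G2 cg2 by simp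
  have nz: "G - g \<noteq> 0" "G + g \<noteq> 0" "G + cnj g \<noteq> 0" "G - cnj g \<noteq> 0"
    using circle_cayley_ne[OF assms] e1 e2 by auto
  have U: "slitmap b (cayley t) = (G - g) / (G + cnj g)"
    by (simp add: slitmap_def moeb_def G_def g_def)
  have "- G + cnj g = - (G - cnj g)" "- G - g = - (G + g)" by simp_all
  then have D: "dualmap b (cayley t) = (G + g) / (G - cnj g)"
    unfolding dualmap_def moeb_def G_def[symmetric] g_def[symmetric] by (simp only: minus_divide_divide)
  show U0: "slitmap b (cayley t) \<noteq> 0" and D0: "dualmap b (cayley t) \<noteq> 0"
    unfolding U D using nz by auto
  have "slitmap b (cayley t) * dualmap b (cayley t) = ((G - g) * (G + g)) / ((G + cnj g) * (G - cnj g))"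
    unfolding U D by simp
  also have "\<dots> = 1 / ((cayley t + \<i>) / (cayley t - \<i>))" unfolding e1 e2 by simp
  finally show "slitmap b (cayley t) * dualmap b (cayley t) = 1 / t"
    unfolding cayley_div[OF assms(2)] .
  have t_eq: "t = (G + cnj g) * (G - cnj g) / ((G - g) * (G + g))"
    using cayley_div[OF assms(2)] unfolding e1 e2 by simp
  have gg: "g + cnj g = of_real (2 * Re g)" "g - cnj g = 2 * \<i> * Im g"
    by (simp_all add: complex_eq_iff)
  have RI: "of_real (2 * Re g) * of_real (Im g) = (1 :: complex)"
    using Re_Im_gam[of b] unfolding g_def by (metis of_real_1 of_real_mult)
  have "1 / slitmap b (cayley t) + 1 / dualmap b (cayley t)
      = ((G + cnj g) * (G + g) + (G - cnj g) * (G - g)) / ((G - g) * (G + g))"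
    unfolding U D using nz by (simp add: divide_simps)
  also have "(G + cnj g) * (G + g) + (G - cnj g) * (G - g) = 2 * (G\<^sup>2 + g * cnj g)"
    by (simp add: power2_eq_square algebra_simps)
  \<comment> \<open>The normalisation \<open>2 * Re g * Im g = 1\<close> gives
    \<open>(- 2 * \<i> * Re g) * (g - cnj g) = 2\<close>.\<close>
  also have "2 * (G\<^sup>2 + g * cnj g) = (- 2 * \<i> * Re g) * ((g - cnj g) * (G\<^sup>2 + g * cnj g))"
  proof -
    have "(- 2 * \<i> * Re g) * (g - cnj g) = 2 * (of_real (2 * Re g) * of_real (Im g))"
      unfolding gg by simp
    then have "(- 2 * \<i> * Re g) * (g - cnj g) = 2" unfolding RI by simp
    then show ?thesis by (metis mult.assoc)
  qed
  also have "(g - cnj g) * (G\<^sup>2 + g * cnj g) = g * ((G + cnj g) * (G - cnj g)) - cnj g * ((G - g) * (G + g))"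
    by (simp add: power2_eq_square algebra_simps)
  also have "(- 2 * \<i> * Re g) * (g * ((G + cnj g) * (G - cnj g)) - cnj g * ((G - g) * (G + g))) / ((G - g) * (G + g))
     = (- 2 * \<i> * Re g) * (g * t - cnj g)"
    unfolding t_eq using nz by (simp add: divide_simps)
  finally show "1 / slitmap b (cayley t) + 1 / dualmap b (cayley t)
      = (- 2 * \<i> * Re (gam b)) * (gam b * t - cnj (gam b))" unfolding g_def .
qed

text \<open>Newton's recursion for the power sums of the two roots with sum \<open>faber b 1\<close>
  and product \<open>t\<close>; the zeroth power sum is \<open>2\<close>.\<close>

fun faber :: "real \<Rightarrow> nat \<Rightarrow> complex poly" where
  "faber b 0 = [:2:]"
| "faber b (Suc 0) = smult (- 2 * \<i> * Re (gam b)) [:- cnj (gam b), gam b:]"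
| "faber b (Suc (Suc k)) = faber b (Suc 0) * faber b (Suc k) - [:0, 1:] * faber b k"

declare faber.simps(3) [simp del]

lemma poly_faber:
  assumes "cmod t = 1" "t \<noteq> 1"
  shows "poly (faber b k) t = (1 / slitmap b (cayley t)) ^ k + (1 / dualmap b (cayley t)) ^ k"
proof (induction b k rule: faber.induct)
  case (3 b k)
  define A where "A = 1 / slitmap b (cayley t)"
  define C where "C = 1 / dualmap b (cayley t)"
  have t0: "t \<noteq> 0" using assms by auto
  have "A * C = 1 / (slitmap b (cayley t) * dualmap b (cayley t))" unfolding A_def C_def by simp
  then have AC: "A * C = t" unfolding slitmap_dualmap(1)[OF assms] by simp
  have "poly (faber b (Suc (Suc k))) t = (A + C) * (A ^ Suc k + C ^ Suc k) - (A * C) * (A ^ k + C ^ k)"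
  proof -
    have f1: "poly (faber b (Suc 0)) t = A + C" and f2: "poly (faber b (Suc k)) t = A ^ Suc k + C ^ Suc k"
      and f3: "poly (faber b k) t = A ^ k + C ^ k"
      using 3 unfolding A_def C_def by (simp_all del: faber.simps)
    show ?thesis unfolding faber.simps(3) poly_diff poly_mult f1 f2 f3 AC by simp
  qed
  also have "\<dots> = A ^ Suc (Suc k) + C ^ Suc (Suc k)" by (simp add: algebra_simps)
  finally show ?case unfolding A_def C_def .
qed (use slitmap_dualmap(4)[OF assms] in \<open>simp_all add: algebra_simps\<close>)

text \<open>The leading coefficient of \<open>faber b 1\<close>.\<close>

definition lead_const :: "real \<Rightarrow> complex" where
  "lead_const b = - 2 * \<i> * Re (gam b) * gam b"

lemma cmod_lead_const: "cmod (lead_const b) = 1 / arc_cap b"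
  unfolding lead_const_def arc_cap_def using Re_gam_pos[of b] by (simp add: norm_mult)

lemma lead_const_nz: "lead_const b \<noteq> 0"
  using cmod_lead_const[of b] arc_cap_pos[of b] by auto

lemma degree_faber_le: "degree (faber b k) \<le> k"
proof (induction b k rule: faber.induct)
  case (3 b k)
  have "degree (faber b (Suc 0) * faber b (Suc k)) \<le> Suc (Suc k)"
    using degree_mult_le[of "faber b (Suc 0)" "faber b (Suc k)"] 3(1,2) by linarith
  moreover have "degree ([:0, 1:] * faber b k) \<le> Suc (Suc k)"
    using degree_mult_le[of "[:0, 1:]" "faber b k"] 3(3) by (auto intro: order_trans)
  ultimately show ?case unfolding faber.simps(3) by (rule degree_diff_le)
qed (auto intro: order_trans[OF degree_smult_le])

text \<open>The product with the linear polynomial carries the top coefficient, while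
  \<open>[:0, 1:] * faber b k\<close> has too small a degree. The case \<open>k = 0\<close> differs
  because \<open>faber b 0\<close> is \<open>2\<close>.\<close>

lemma coeff_faber: "k > 0 \<Longrightarrow> coeff (faber b k) k = lead_const b ^ k"
proof (induction b k rule: faber.induct)
  case (3 b k)
  have "coeff (faber b (Suc (Suc k))) (Suc (Suc k))
     = lead_const b * coeff (faber b (Suc k)) (Suc k)
       + coeff (faber b (Suc 0)) 0 * coeff (faber b (Suc k)) (Suc (Suc k)) - coeff (faber b k) (Suc k)"
    by (simp add: faber.simps(3) lead_const_def algebra_simps)
  also have "coeff (faber b (Suc k)) (Suc (Suc k)) = 0"
    by (rule coeff_eq_0) (use degree_faber_le[of b "Suc k"] in simp)
  also have "coeff (faber b k) (Suc k) = 0"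
    by (rule coeff_eq_0) (use degree_faber_le[of b k] in simp)
  finally show ?case using 3(2) by simp
qed (simp_all add: lead_const_def)

text \<open>With \<open>c = lead_const b\<close> and \<open>U\<close>, \<open>D\<close> the two
  branches, the combination of \<open>faber b (m - k)\<close> with the coefficients of
  \<open>E\<close> equals \<open>c ^ m * poly R t = U ^ (-m) * E(U) + D ^ (-m) * E(D)\<close>, and
  \<open>cmod D = 1 / cmod U\<close> on the circle. As \<open>degree E < m\<close>, only the term
  \<open>k = 0\<close> reaches degree \<open>m\<close>, with coefficient \<open>E(0) = 1\<close>;
  any such \<open>E\<close> may thus modulate the Faber polynomial.\<close>

lemma monic_faber_combination:
  assumes E0: "poly E 0 = 1" and m: "degree E < m"
  shows "\<exists>R. degree R = m \<and> lead_coeff R = 1 \<and>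
    (\<forall>t. cmod t = 1 \<longrightarrow> t \<noteq> 1 \<longrightarrow>
      cmod (slitmap b (cayley t)) ^ m * cmod (poly R t) \<le>
        arc_cap b ^ m * (cmod (poly E (slitmap b (cayley t)))
          + cmod (slitmap b (cayley t)) ^ (2 * m) * cmod (poly E (dualmap b (cayley t)))))"
proof -
  define c where "c = lead_const b"
  have c0: "c \<noteq> 0" unfolding c_def by (rule lead_const_nz)
  define R where "R = smult (1 / c ^ m) (\<Sum>k\<le>degree E. smult (coeff E k) (faber b (m - k)))"
  have deg: "degree R \<le> m"
    unfolding R_def
    by (intro order_trans[OF degree_smult_le] degree_sum_le order_trans[OF degree_faber_le]) auto
  have "coeff R m = 1 / c ^ m * (\<Sum>k\<le>degree E. coeff E k * coeff (faber b (m - k)) m)"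
    by (simp add: R_def coeff_sum)
  also have "(\<Sum>k\<le>degree E. coeff E k * coeff (faber b (m - k)) m) = (\<Sum>k\<le>degree E. if k = 0 then c ^ m else 0)"
  proof (intro sum.cong refl)
    fix k assume "k \<in> {..degree E}"
    show "coeff E k * coeff (faber b (m - k)) m = (if k = 0 then c ^ m else 0)"
    proof (cases "k = 0")
      case True then show ?thesis using E0 m by (simp add: coeff_faber poly_0_coeff_0 c_def)
    next
      case False
      then have "coeff (faber b (m - k)) m = 0"
        using m by (intro coeff_eq_0 le_less_trans[OF degree_faber_le]) auto
      then show ?thesis using False by simp
    qed
  qed
  also have "\<dots> = c ^ m" by (simp add: sum.delta)
  finally have cm: "coeff R m = 1" using c0 by simp
  then have degR: "degree R = m" using deg by (metis le_antisym le_degree zero_neq_one)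
  moreover have "cmod (slitmap b (cayley t)) ^ m * cmod (poly R t) \<le>
        arc_cap b ^ m * (cmod (poly E (slitmap b (cayley t)))
          + cmod (slitmap b (cayley t)) ^ (2 * m) * cmod (poly E (dualmap b (cayley t))))"
    if t: "cmod t = 1" "t \<noteq> 1" for t
  proof -
    define U where "U = slitmap b (cayley t)"
    define D where "D = dualmap b (cayley t)"
    have U0: "U \<noteq> 0" and D0: "D \<noteq> 0" unfolding U_def D_def by (rule slitmap_dualmap[OF t])+
    have UD: "U * D = 1 / t" unfolding U_def D_def by (rule slitmap_dualmap[OF t])
    have "cmod U * cmod D = 1" using arg_cong[OF UD, of cmod] t by (simp add: norm_mult norm_divide)
    then have nD: "1 / cmod D = cmod U" using D0 by (simp add: field_simps)
    have pe: "(\<Sum>k\<le>degree E. coeff E k * (1 / Z) ^ (m - k)) = (1 / Z) ^ m * poly E Z" if "Z \<noteq> 0" for Z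
    proof -
      have "(1 / Z) ^ (m - k) = (1 / Z) ^ m * Z ^ k" if "k \<le> degree E" for k
        using that m \<open>Z \<noteq> 0\<close> by (simp add: power_divide power_diff field_simps)
      then show ?thesis unfolding poly_altdef sum_distrib_left
        by (intro sum.cong) (auto simp: mult_ac)
    qed
    have "poly R t = (1 / c ^ m) * (\<Sum>k\<le>degree E. coeff E k * ((1 / U) ^ (m - k) + (1 / D) ^ (m - k)))"
      unfolding R_def U_def D_def by (simp add: poly_sum poly_faber[OF t])
    also have "\<dots> = (1 / c ^ m) * ((1 / U) ^ m * poly E U + (1 / D) ^ m * poly E D)"
      unfolding distrib_left sum.distrib pe[OF U0] pe[OF D0] ..
    finally have "cmod (poly R t) = arc_cap b ^ m * cmod ((1 / U) ^ m * poly E U + (1 / D) ^ m * poly E D)"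
      by (simp add: norm_mult norm_divide norm_power c_def cmod_lead_const power_divide)
    also have "\<dots> \<le> arc_cap b ^ m * (cmod ((1 / U) ^ m * poly E U) + cmod ((1 / D) ^ m * poly E D))"
      using arc_cap_pos[of b] by (intro mult_left_mono norm_triangle_ineq) auto
    also have "cmod ((1 / D) ^ m * poly E D) = cmod U ^ m * cmod (poly E D)"
      by (simp add: norm_mult norm_power norm_divide nD)
    finally have "cmod U ^ m * cmod (poly R t) \<le>
       cmod U ^ m * (arc_cap b ^ m * (cmod ((1 / U) ^ m * poly E U) + cmod U ^ m * cmod (poly E D)))"
      by (intro mult_left_mono) auto
    also have "cmod U ^ m * (arc_cap b ^ m * (cmod ((1 / U) ^ m * poly E U) + cmod U ^ m * cmod (poly E D)))
       = arc_cap b ^ m * ((cmod U ^ m * cmod ((1 / U) ^ m * poly E U)) + cmod U ^ (2 * m) * cmod (poly E D))"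
      unfolding mult_2 power_add by (simp add: distrib_left mult_ac)
    also have "cmod U ^ m * cmod ((1 / U) ^ m * poly E U) = cmod (poly E U)"
      using U0 by (simp add: norm_mult norm_power norm_divide power_divide)
    finally show ?thesis unfolding U_def D_def .
  qed
  ultimately show ?thesis using cm by blast
qed

text \<open>The preceding construction with \<open>E = 1\<close>; each of the two branches
  contributes at most \<open>1\<close>.\<close>

lemma chebyshev_arc:
  "\<exists>R. degree R = m \<and> lead_coeff R = 1 \<and>
    (\<forall>t. cmod t = 1 \<longrightarrow> t \<noteq> 1 \<longrightarrow>
      cmod (slitmap b (cayley t)) ^ m * cmod (poly R t) \<le> 2 * arc_cap b ^ m)"
proof (cases "m = 0")
  case True
  then show ?thesis by (intro exI[of _ "1"]) auto
next
  case False
  then obtain R where R: "degree R = m" "lead_coeff R = 1"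
    "\<And>t. cmod t = 1 \<Longrightarrow> t \<noteq> 1 \<Longrightarrow>
      cmod (slitmap b (cayley t)) ^ m * cmod (poly R t) \<le>
        arc_cap b ^ m * (cmod (poly 1 (slitmap b (cayley t)))
          + cmod (slitmap b (cayley t)) ^ (2 * m) * cmod (poly 1 (dualmap b (cayley t))))"
    using monic_faber_combination[of 1 m b] by auto
  have "arc_cap b ^ m * (cmod (poly 1 (slitmap b (cayley t)))
          + cmod (slitmap b (cayley t)) ^ (2 * m) * cmod (poly 1 (dualmap b (cayley t)))) \<le> 2 * arc_cap b ^ m" for t
    using arc_cap_pos[of b] power_le_one[OF norm_ge_zero cmod_slitmap_le_1[of b "cayley t"], of "2 * m"]
    by (simp add: mult_ac)
  then show ?thesis using R by (intro exI[of _ R] conjI allI impI) (auto intro: order_trans)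
qed

section \<open>Polynomials that are small off a weighted neighbourhood of one endpoint\<close>

text \<open>Taylor polynomials: as \<open>1 < R\<close>, the coefficients are absolutely summable,
  which makes the error uniform on the closed disc.\<close>

lemma uniform_poly_approx:
  assumes f: "f holomorphic_on ball 0 R" and R: "1 < R" and e: "0 < e"
  shows "\<exists>p :: complex poly. poly p 0 = f 0 \<and> (\<forall>u. cmod u \<le> 1 \<longrightarrow> cmod (poly p u - f u) \<le> e)"
proof -
  define a where "a n = (deriv ^^ n) f 0 / fact n" for n
  have ser: "(\<lambda>n. a n * z ^ n) sums f z" if "cmod z < R" for z
    using holomorphic_power_series[OF f, of z] that by (simp add: a_def)
  obtain s where s: "1 < s" "s < R" using R dense by blast
  have sum_a: "summable (\<lambda>n. cmod (a n))"
  proof -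
    have "summable (\<lambda>n. a n * of_real s ^ n)"
      using ser[of "of_real s"] s by (auto simp: sums_iff)
    then have "summable (\<lambda>n. cmod (a n * 1 ^ n))"
      by (rule powser_insidea) (use s in auto)
    then show ?thesis by simp
  qed
  obtain N where N: "\<And>n. n \<ge> N \<Longrightarrow> norm (\<Sum>i. cmod (a (i + n))) < e"
    using suminf_exist_split[OF e sum_a] by blast
  \<comment> \<open>At least one term is kept, so that the constant coefficient is
    \<open>f 0\<close>.\<close>
  define n where "n = Suc N"
  define p where "p = (\<Sum>i<n. monom (a i) i)"
  have pp: "poly p u = (\<Sum>i<n. a i * u ^ i)" for u
    by (simp add: p_def poly_sum poly_monom)
  have f0: "f 0 = a 0" by (simp add: a_def)
  have "poly p 0 = f 0" unfolding pp n_def f0 by (simp add: lessThan_Suc_eq_insert_0 sum.insert_if power_0_left image_iff sum.reindex)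
  moreover have "cmod (poly p u - f u) \<le> e" if u: "cmod u \<le> 1" for u
  proof -
    have fu: "(\<lambda>i. a i * u ^ i) sums f u" using ser u R by auto
    have sm: "summable (\<lambda>i. cmod (a (i + n)))" using sum_a by (rule summable_ignore_initial_segment)
    have le: "cmod (a (i + n) * u ^ (i + n)) \<le> cmod (a (i + n))" for i
      using u by (simp add: norm_mult norm_power mult_left_le power_le_one)
    have sm2: "summable (\<lambda>i. cmod (a (i + n) * u ^ (i + n)))"
      by (rule summable_comparison_test'[OF sm, of 0]) (use le in simp)
    have "f u - poly p u = (\<Sum>i. a (i + n) * u ^ (i + n))"
      unfolding pp using suminf_minus_initial_segment[of "\<lambda>i. a i * u ^ i" n] fu by (auto simp: sums_iff)
    then have "cmod (poly p u - f u) \<le> (\<Sum>i. cmod (a (i + n) * u ^ (i + n)))"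
      using summable_norm[OF sm2] by (simp add: norm_minus_commute)
    also have "\<dots> \<le> (\<Sum>i. cmod (a (i + n)))" by (rule suminf_le[OF le sm2 sm])
    also have "\<dots> \<le> e" using N[of n] by (simp add: n_def)
    finally show ?thesis .
  qed
  ultimately show ?thesis by blast
qed

text \<open>The kernel \<open>exp_kernel M r\<close> is a regularisation, by \<open>r < 1\<close>, of the exponential of the
  Martin function of the slit domain with pole at infinity.\<close>

definition exp_kernel :: "real \<Rightarrow> real \<Rightarrow> complex \<Rightarrow> complex" where
  "exp_kernel M r u = exp (of_real M * ((1 + of_real r * u) / (1 - of_real r * u) - 1))"

lemma cmod_exp_kernel:
  "cmod (exp_kernel M r u) = exp (M * (Re ((1 + of_real r * u) / (1 - of_real r * u)) - 1))"
  by (simp add: exp_kernel_def del: of_real_mult)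

lemma exp_kernel_holomorphic:
  assumes "0 < r" "r < 1"
  shows "exp_kernel M r holomorphic_on ball 0 (1 / r)"
  unfolding exp_kernel_def[abs_def]
proof (intro holomorphic_intros)
  fix u :: complex assume "u \<in> ball 0 (1 / r)"
  then have "cmod (of_real r * u) < 1" using assms by (simp add: norm_mult field_simps)
  then show "1 - of_real r * u \<noteq> 0" by auto
qed

text \<open>The distance from \<open>r * u\<close> to \<open>1\<close> is at least
  \<open>1 - r\<close>, and \<open>u\<close> is within \<open>1 - r\<close> of \<open>r * u\<close>.
  The resulting constant \<open>2\<close> does not depend on \<open>r\<close>.\<close>

lemma one_minus_ru:
  assumes "0 < r" "r < 1" "cmod u \<le> 1"
  shows "cmod (1 - u) \<le> 2 * cmod (1 - of_real r * u)"
proof -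
  have "cmod (of_real r * u) \<le> r" using assms by (simp add: norm_mult mult_left_le)
  then have 1: "1 - r \<le> cmod (1 - of_real r * u)"
    using norm_triangle_ineq2[of 1 "of_real r * u"] by simp
  have "1 - u = (1 - of_real r * u) - of_real (1 - r) * u" by (simp add: algebra_simps)
  then have "cmod (1 - u) \<le> cmod (1 - of_real r * u) + cmod (of_real (1 - r) * u)"
    by (metis norm_triangle_ineq4)
  also have "cmod (of_real (1 - r) * u) = (1 - r) * cmod u"
    using assms by (simp only: norm_mult norm_of_real)
  also have "\<dots> \<le> 1 - r" using assms by (simp add: mult_left_le)
  finally show ?thesis using 1 by simp
qed

text \<open>A crude bound, but uniform in \<open>r\<close>: it is used far out on the line, in a
  range fixed before \<open>r\<close> is chosen.\<close>

lemma cmod_exp_kernel_le1: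
  assumes "0 < r" "r < 1" "cmod u \<le> 1" "u \<noteq> 1" "0 \<le> M"
  shows "cmod (exp_kernel M r u) \<le> exp (4 * M / cmod (1 - u))"
proof -
  have p: "0 < cmod (1 - u)" using assms by simp
  have ru: "cmod (of_real r * u) \<le> 1" using assms by (simp add: norm_mult mult_le_one)
  have "Re ((1 + of_real r * u) / (1 - of_real r * u)) \<le> cmod (1 + of_real r * u) / cmod (1 - of_real r * u)"
    using complex_Re_le_cmod[of "(1 + of_real r * u) / (1 - of_real r * u)"] by (simp add: norm_divide)
  also have "\<dots> \<le> 2 / (cmod (1 - u) / 2)"
    using one_minus_ru[OF assms(1-3)] p ru norm_triangle_ineq[of 1 "of_real r * u"]
    by (intro frac_le) auto
  finally have "Re ((1 + of_real r * u) / (1 - of_real r * u)) - 1 \<le> 4 / cmod (1 - u)" by simp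
  then have "M * (Re ((1 + of_real r * u) / (1 - of_real r * u)) - 1) \<le> M * (4 / cmod (1 - u))"
    using assms by (intro mult_left_mono) auto
  then show ?thesis unfolding cmod_exp_kernel by (simp add: mult_ac)
qed

text \<open>A comparison with the kernel for \<open>r = 1\<close>; it is used where \<open>u\<close>
  stays away from \<open>1\<close>, so that the error is small for \<open>r\<close> close to
  \<open>1\<close>.\<close>

lemma cmod_exp_kernel_le2:
  assumes "0 < r" "r < 1" "cmod u \<le> 1" "u \<noteq> 1" "0 \<le> M"
  shows "cmod (exp_kernel M r u) \<le> exp (M * (Re ((1 + u) / (1 - u)) - 1 + 4 * (1 - r) / (cmod (1 - u))\<^sup>2))"
proof -
  define v where "v = of_real r * u"
  have p: "0 < cmod (1 - u)" using assms by simp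
  have p2: "cmod (1 - u) \<le> 2 * cmod (1 - v)" unfolding v_def by (rule one_minus_ru[OF assms(1-3)])
  have nz: "1 - u \<noteq> 0" "1 - v \<noteq> 0" using p p2 by auto
  have "(1 + v) / (1 - v) - (1 + u) / (1 - u) = 2 * (v - u) / ((1 - v) * (1 - u))"
    using nz by (simp add: divide_simps) (simp add: algebra_simps)
  moreover have "cmod (v - u) \<le> 1 - r"
  proof -
    have "v - u = of_real (r - 1) * u" by (simp add: v_def algebra_simps)
    then have "cmod (v - u) = (1 - r) * cmod u" using assms by (simp only: norm_mult norm_of_real) simp
    then show ?thesis using assms by (simp add: mult_left_le)
  qed
  moreover have "cmod (2 * (v - u) / ((1 - v) * (1 - u))) = 2 * cmod (v - u) / (cmod (1 - v) * cmod (1 - u))"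
    by (simp only: norm_mult norm_divide norm_numeral)
  moreover have "2 * cmod (v - u) / (cmod (1 - v) * cmod (1 - u)) \<le> 2 * (1 - r) / ((cmod (1 - u) / 2) * cmod (1 - u))"
    using p p2 assms calculation(2) by (intro frac_le mult_mono mult_pos_pos) auto
  ultimately have "cmod ((1 + v) / (1 - v) - (1 + u) / (1 - u)) \<le> 2 * (1 - r) / ((cmod (1 - u) / 2) * cmod (1 - u))"
    by simp
  also have "\<dots> = 4 * (1 - r) / (cmod (1 - u))\<^sup>2" by (simp add: power2_eq_square)
  finally have "Re ((1 + v) / (1 - v)) - Re ((1 + u) / (1 - u)) \<le> 4 * (1 - r) / (cmod (1 - u))\<^sup>2"
    by (metis (no_types) complex_Re_le_cmod minus_complex.sel(1) order_trans)
  then show ?thesis unfolding cmod_exp_kernel v_def[symmetric] using assms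
    by (auto intro!: mult_left_mono)
qed

section \<open>The kernel in the half-plane coordinate\<close>

lemma one_minus_moeb:
  assumes "G + cnj g \<noteq> 0"
  shows "1 - moeb g G = 2 * Re g / (G + cnj g)"
  using assms by (simp add: moeb_def field_simps complex_add_cnj)

text \<open>In the coordinate \<open>G\<close> the Martin function is \<open>Re G\<close>,
  normalised to be \<open>1\<close> at \<open>g\<close>; so it vanishes on the slit and grows like a
  square root at infinity.\<close>

lemma cayley_moeb:
  assumes "G + cnj g \<noteq> 0" "Re g > 0"
  shows "Re ((1 + moeb g G) / (1 - moeb g G)) = Re G / Re g"
proof -
  have "1 + moeb g G = (2 * G - 2 * \<i> * Im g) / (G + cnj g)"
    using assms by (simp add: moeb_def field_simps) (simp add: complex_eq_iff)
  then have "(1 + moeb g G) / (1 - moeb g G) = (2 * G - 2 * \<i> * Im g) / of_real (2 * Re g)"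
    unfolding one_minus_moeb[OF assms(1)] using assms by (simp add: divide_simps)
  also have "Re \<dots> = Re G / Re g" unfolding Re_divide_of_real by simp
  finally show ?thesis .
qed

lemma moeb_ne_1: "G + cnj g \<noteq> 0 \<Longrightarrow> Re g > 0 \<Longrightarrow> moeb g G \<noteq> 1"
  using one_minus_moeb[of G g] by auto

lemma inverse_one_minus_moeb_le:
  assumes "G + cnj g \<noteq> 0" "Re g > 0" "cmod G \<le> B"
  shows "2 * Re g / (B + cmod g) \<le> cmod (1 - moeb g G)"
proof -
  have "cmod (G + cnj g) \<le> B + cmod g" using norm_triangle_ineq[of G "cnj g"] assms by simp
  moreover have "0 < cmod (G + cnj g)" using assms by simp
  moreover have "cmod (1 - moeb g G) = 2 * Re g / cmod (G + cnj g)"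
    unfolding one_minus_moeb[OF assms(1)] using assms by (simp add: norm_divide norm_mult)
  ultimately show ?thesis using assms by (simp add: frac_le)
qed

text \<open>A bound below \<open>1\<close> for the slit map, uniform on a compact part of the open
  gap; high powers are then uniformly small there.\<close>

lemma cmod_moeb_real_less:
  assumes "Re g > 0" "0 < g0" "g0 \<le> G" "G \<le> G1"
  shows "cmod (moeb g (of_real G)) \<le> sqrt (1 - 4 * g0 * Re g / (G1 + cmod g)\<^sup>2)"
    and "sqrt (1 - 4 * g0 * Re g / (G1 + cmod g)\<^sup>2) < 1"
proof -
  have nz: "of_real G + cnj g \<noteq> 0" using assms by (intro moeb_denom_nz) auto
  have "(cmod (of_real G + cnj g))\<^sup>2 \<le> (G1 + cmod g)\<^sup>2"
    using norm_triangle_ineq[of "of_real G" "cnj g"] assms by (intro power_mono) auto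
  moreover have "0 < (cmod (of_real G + cnj g))\<^sup>2" using nz by simp
  ultimately have "4 * g0 * Re g / (G1 + cmod g)\<^sup>2 \<le> 4 * G * Re g / (cmod (of_real G + cnj g))\<^sup>2"
    using assms by (intro frac_le mult_mono) auto
  then have "(cmod (moeb g (of_real G)))\<^sup>2 \<le> 1 - 4 * g0 * Re g / (G1 + cmod g)\<^sup>2"
    using assms by (subst cmod_moeb_sq) auto
  then show "cmod (moeb g (of_real G)) \<le> sqrt (1 - 4 * g0 * Re g / (G1 + cmod g)\<^sup>2)"
    by (rule real_le_rsqrt)
  have "0 < 4 * g0 * Re g / (G1 + cmod g)\<^sup>2"
    using assms by (intro divide_pos_pos mult_pos_pos zero_less_power) (auto intro: add_pos_nonneg)
  then show "sqrt (1 - 4 * g0 * Re g / (G1 + cmod g)\<^sup>2) < 1" by simp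
qed

text \<open>The exponent of \<open>\<bar>x\<bar>\<close> is \<open>2 * 3/8 = 3/4\<close>. It exceeds
  the growth \<open>1/2\<close> of the Martin function and is below \<open>1\<close>, the bound for
  integrability on the circle, where \<open>\<bar>x\<bar>\<close> behaves like
  \<open>2 / cmod (t - 1)\<close>.\<close>

definition line_weight :: "real \<Rightarrow> real" where
  "line_weight x = exp (- ((1 + x\<^sup>2) powr (3/8)))"

lemma line_weight_pos: "0 < line_weight x" by (simp add: line_weight_def)
lemma line_weight_le_1: "line_weight x \<le> 1" by (simp add: line_weight_def)

lemma sqrt_line_weight: "sqrt (line_weight x) = exp (- ((1 + x\<^sup>2) powr (3/8) / 2))"
  by (rule real_sqrt_unique) (simp_all add: line_weight_def exp_double[symmetric])

lemma line_weight_dominates: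
  assumes "a > 0"
  shows "((\<lambda>x. sqrt (line_weight x) * (exp (a * sqrt (b - x) + c) + d)) \<longlongrightarrow> 0) at_bot"
proof -
  have "((\<lambda>x. exp (- ((1 + x\<^sup>2) powr (3/8) / 2)) * exp (a * sqrt (b + x) + c)) \<longlongrightarrow> 0) at_top"
    using assms by real_asymp
  moreover have "((\<lambda>x. exp (- ((1 + x\<^sup>2) powr (3/8) / 2)) * d) \<longlongrightarrow> 0) at_top"
    by real_asymp
  ultimately have "((\<lambda>x. exp (- ((1 + x\<^sup>2) powr (3/8) / 2)) * exp (a * sqrt (b + x) + c)
      + exp (- ((1 + x\<^sup>2) powr (3/8) / 2)) * d) \<longlongrightarrow> 0 + 0) at_top" by (rule tendsto_add)
  then show ?thesis unfolding sqrt_line_weight filterlim_at_bot_mirror by (simp add: distrib_left)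
qed

lemma line_weight_tendsto: "((\<lambda>x. sqrt (line_weight x) * d) \<longlongrightarrow> 0) at_top"
  unfolding sqrt_line_weight by real_asymp

lemma power_small:
  assumes "0 \<le> \<rho>" "\<rho> < 1" "0 < e"
  shows "\<exists>N. \<forall>n\<ge>N. \<rho> ^ n \<le> (e :: real)"
proof -
  have "(\<lambda>n. \<rho> ^ n) \<longlonglongrightarrow> 0" using assms by (intro LIMSEQ_power_zero) auto
  then have "\<forall>\<^sub>F n in sequentially. \<rho> ^ n < e" using assms(3) by (rule order_tendstoD)
  then show ?thesis unfolding eventually_sequentially by (meson less_imp_le)
qed

text \<open>From left to right on the line: the weight absorbs the growth of the kernel; the kernel is small;
  inside the gap it stays small as long as \<open>sqrt (x - b) \<le> 3/5 Re (gam b)\<close>, where the second branch is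
  controlled by continuity near \<open>b\<close> and by \<open>\<bar>u\<^sub>b\<bar>\<^bsup>2m\<^esup>\<close> further away; then \<open>\<bar>u\<^sub>b\<^sub>'\<bar>\<^bsup>h\<^esup>\<close> is small;
  and near infinity the weight takes over again.\<close>

lemma weighted_arc_polynomial_aux:
  assumes bb: "b < b'" "b' \<le> b + (Re (gam b))\<^sup>2 / 4" and e: "0 < \<epsilon>" "\<epsilon> \<le> 1"
  shows "\<exists>E m0 H. poly E 0 = 1 \<and> (\<forall>m\<ge>m0. \<forall>h\<ge>H. \<forall>x::real.
      sqrt (line_weight x) * (cmod (poly E (slitmap b (of_real x)))
        + cmod (slitmap b (of_real x)) ^ (2 * m) * cmod (poly E (dualmap b (of_real x))))
        * cmod (slitmap b' (of_real x)) ^ h \<le> \<epsilon>)"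
proof -
  define g where "g = gam b"
  define \<alpha> where "\<alpha> = Re g"
  define \<beta> where "\<beta> = Im g"
  have a0: "0 < \<alpha>" and b0: "0 < \<beta>" unfolding \<alpha>_def \<beta>_def g_def by (rule Re_gam_pos Im_gam_pos)+
  have gR: "Re g > 0" using a0 by (simp add: \<alpha>_def)
  \<comment> \<open>Chosen so that \<open>exp (- M / 4) = \<epsilon> / 8\<close>; the approximation
    error of \<open>E\<close> adds another \<open>\<epsilon> / 8\<close>.\<close>
  define M where "M = 4 * ln (8 / \<epsilon>)"
  have M0: "0 < M" using e by (simp add: M_def)
  have expM: "exp (- M / 4) = \<epsilon> / 8" using e by (simp add: M_def exp_minus)
  have wt1: "sqrt (line_weight x) \<le> 1" "0 \<le> sqrt (line_weight x)" for x using line_weight_le_1[of x] line_weight_pos[of x] by auto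
  \<comment> \<open>The cut \<open>X0\<close> is fixed before \<open>r\<close>; this is possible
    because the growth bound \<open>far\<close> does not involve \<open>r\<close>.\<close>
  have "\<forall>\<^sub>F x in at_bot. sqrt (line_weight x) * (exp (2 * M / \<alpha> * sqrt (b - x) + 2 * M / \<alpha> * cmod g) + 1) < \<epsilon> / 2"
    by (rule order_tendstoD(2)[OF line_weight_dominates]) (use M0 a0 e in auto)
  then obtain X0 where X0: "\<And>x. x \<le> X0 \<Longrightarrow>
      sqrt (line_weight x) * (exp (2 * M / \<alpha> * sqrt (b - x) + 2 * M / \<alpha> * cmod g) + 1) < \<epsilon> / 2"
    unfolding eventually_at_bot_linorder by blast
  define B where "B = sqrt \<bar>b - X0\<bar> + \<alpha>"
  have B0: "0 < B" using a0 by (simp add: B_def add_nonneg_pos)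
  \<comment> \<open>\<open>C\<close> bounds \<open>4 / (cmod (1 - u))\<^sup>2\<close> for all
    \<open>u = moeb g G\<close> with \<open>cmod G \<le> B\<close>; \<open>r\<close> is then so
    close to \<open>1\<close> that the regularisation error is at most \<open>1/10\<close>.\<close>
  define C where "C = 4 * ((B + cmod g) / (2 * \<alpha>))\<^sup>2"
  have "0 < (B + cmod g) / (2 * \<alpha>)" using B0 a0 by (intro divide_pos_pos add_pos_nonneg) auto
  then have C0: "0 < C" unfolding C_def by (intro mult_pos_pos zero_less_power) auto
  define r where "r = 1 - min (1/2) (1 / (10 * C))"
  have r: "0 < r" "r < 1" using C0 by (auto simp: r_def)
  have rC: "C * (1 - r) \<le> 1/10"
  proof -
    have "1 - r \<le> 1 / (10 * C)" by (simp add: r_def)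
    then have "C * (1 - r) \<le> C * (1 / (10 * C))" using C0 by (intro mult_left_mono) auto
    then show ?thesis using C0 by simp
  qed
  have hol: "exp_kernel M r holomorphic_on ball 0 (1 / r)" by (rule exp_kernel_holomorphic[OF r])
  obtain E where E: "poly E 0 = exp_kernel M r 0"
    "\<And>u. cmod u \<le> 1 \<Longrightarrow> cmod (poly E u - exp_kernel M r u) \<le> \<epsilon> / 8"
    using uniform_poly_approx[OF hol, of "\<epsilon> / 8"] r e by auto
  have E0: "poly E 0 = 1" unfolding E(1) by (simp add: exp_kernel_def)
  have Ele: "cmod (poly E u) \<le> cmod (exp_kernel M r u) + \<epsilon> / 8" if "cmod u \<le> 1" for u
    using E(2)[OF that] norm_triangle_ineq2[of "poly E u" "exp_kernel M r u"] by linarith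
  have far: "cmod (poly E (moeb g G)) \<le> exp (2 * M / \<alpha> * cmod G + 2 * M / \<alpha> * cmod g) + \<epsilon> / 8"
    if "Re G \<ge> 0" for G
  proof -
    have nz: "G + cnj g \<noteq> 0" using gR that by (rule moeb_denom_nz)
    have u1: "cmod (moeb g G) \<le> 1" using gR that by (rule cmod_moeb_le_1)
    have "2 * \<alpha> / (cmod G + cmod g) \<le> cmod (1 - moeb g G)"
      unfolding \<alpha>_def by (rule inverse_one_minus_moeb_le[OF nz gR]) simp
    moreover have "0 < 2 * \<alpha> / (cmod G + cmod g)" using a0 gR
      by (intro divide_pos_pos add_nonneg_pos) auto
    ultimately have "4 * M / cmod (1 - moeb g G) \<le> 4 * M / (2 * \<alpha> / (cmod G + cmod g))"
      using M0 by (intro divide_left_mono mult_pos_pos) auto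
    also have "\<dots> = 2 * M / \<alpha> * cmod G + 2 * M / \<alpha> * cmod g"
      using a0 by (simp add: field_simps)
    finally have "cmod (exp_kernel M r (moeb g G)) \<le> exp (2 * M / \<alpha> * cmod G + 2 * M / \<alpha> * cmod g)"
      using cmod_exp_kernel_le1[OF r u1 moeb_ne_1[OF nz gR], of M] M0 by (meson exp_le_cancel_iff less_imp_le order_trans)
    then show ?thesis using Ele[OF u1] by simp
  qed
  have near: "cmod (poly E (moeb g G)) \<le> \<epsilon> / 4" if "Re G \<ge> 0" "Re G \<le> 3/5 * \<alpha>" "cmod G \<le> B" for G
  proof -
    have nz: "G + cnj g \<noteq> 0" using gR that(1) by (rule moeb_denom_nz)
    have u1: "cmod (moeb g G) \<le> 1" using gR that(1) by (rule cmod_moeb_le_1)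
    have low: "2 * \<alpha> / (B + cmod g) \<le> cmod (1 - moeb g G)"
      unfolding \<alpha>_def by (rule inverse_one_minus_moeb_le[OF nz gR that(3)])
    have p: "0 < 2 * \<alpha> / (B + cmod g)" using a0 B0 by (intro divide_pos_pos add_pos_nonneg) auto
    have "4 * (1 - r) / (cmod (1 - moeb g G))\<^sup>2 \<le> 4 * (1 - r) / (2 * \<alpha> / (B + cmod g))\<^sup>2"
      using low p r by (intro divide_left_mono power_mono mult_pos_pos zero_less_power) auto
    also have "\<dots> = C * (1 - r)" unfolding C_def using a0 by (simp add: power_divide power_mult_distrib field_simps)
    also have "\<dots> \<le> 1/10" by (rule rC)
    finally have 1: "4 * (1 - r) / (cmod (1 - moeb g G))\<^sup>2 \<le> 1/10" .
    have 2: "Re ((1 + moeb g G) / (1 - moeb g G)) \<le> 3/5"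
      unfolding cayley_moeb[OF nz gR] using that(2) a0 by (simp add: \<alpha>_def field_simps)
    \<comment> \<open>Indeed \<open>3/5 - 1 + 1/10 = - 3/10\<close>.\<close>
    have "Re ((1 + moeb g G) / (1 - moeb g G)) - 1 + 4 * (1 - r) / (cmod (1 - moeb g G))\<^sup>2 \<le> - 1/4"
      using 1 2 by linarith
    then have "M * (Re ((1 + moeb g G) / (1 - moeb g G)) - 1 + 4 * (1 - r) / (cmod (1 - moeb g G))\<^sup>2) \<le> M * (- 1/4)"
      using M0 by (intro mult_left_mono) auto
    then have "exp (M * (Re ((1 + moeb g G) / (1 - moeb g G)) - 1 + 4 * (1 - r) / (cmod (1 - moeb g G))\<^sup>2)) \<le> exp (- M / 4)"
      by (subst exp_le_cancel_iff) simp
    then have "cmod (exp_kernel M r (moeb g G)) \<le> exp (- M / 4)"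
      using cmod_exp_kernel_le2[OF r u1 moeb_ne_1[OF nz gR], of M] M0 by linarith
    then show ?thesis using Ele[OF u1] unfolding expM by simp
  qed
  \<comment> \<open>On the gap the second branch leaves the unit disc; \<open>\<Lambda>\<close>
    bounds it there, since \<open>cmod (- s + cnj g)\<close> is at least
    \<open>\<beta>\<close>.\<close>
  define \<Lambda> where "\<Lambda> = 1 + 2 * \<alpha> / \<beta>"
  have L1: "1 \<le> \<Lambda>" using a0 b0 by (simp add: \<Lambda>_def)
  have "bounded (poly E ` cball 0 \<Lambda>)"
    by (intro compact_imp_bounded compact_continuous_image continuous_intros) auto
  then obtain A0 where A0: "\<And>z. cmod z \<le> \<Lambda> \<Longrightarrow> cmod (poly E z) \<le> A0"
    unfolding bounded_iff by (metis imageI mem_cball_0)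
  define A where "A = max A0 1"
  have A: "\<And>z. cmod z \<le> \<Lambda> \<Longrightarrow> cmod (poly E z) \<le> A" "1 \<le> A"
    using A0 unfolding A_def by (auto intro: max.coboundedI1)
  have Dn: "- of_real s + cnj g \<noteq> 0" for s
    using b0 by (auto simp: complex_eq_iff \<beta>_def)
  have Db: "cmod (moeb g (- of_real s)) \<le> \<Lambda>" for s :: real
  proof -
    have p: "\<beta> \<le> cmod (- of_real s + cnj g)"
      using abs_Im_le_cmod[of "- of_real s + cnj g"] b0 by (simp add: \<beta>_def)
    have "- of_real s - g = (- of_real s + cnj g) - of_real (2 * \<alpha>)"
      by (simp add: complex_eq_iff \<alpha>_def)
    moreover have "cmod ((- of_real s + cnj g) - of_real (2 * \<alpha>)) \<le> cmod (- of_real s + cnj g) + cmod (of_real (2 * \<alpha>))"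
      by (rule norm_triangle_ineq4)
    moreover have "cmod (of_real (2 * \<alpha>)) = 2 * \<alpha>" unfolding norm_of_real using a0 by simp
    ultimately have "cmod (- of_real s - g) \<le> cmod (- of_real s + cnj g) + 2 * \<alpha>" by (simp only:)
    then have "cmod (moeb g (- of_real s)) \<le> (cmod (- of_real s + cnj g) + 2 * \<alpha>) / cmod (- of_real s + cnj g)"
      unfolding moeb_def norm_divide by (intro divide_right_mono) auto
    also have "\<dots> = 1 + 2 * \<alpha> / cmod (- of_real s + cnj g)"
      using Dn[of s] by (simp add: add_divide_distrib)
    also have "\<dots> \<le> \<Lambda>" unfolding \<Lambda>_def using p b0 a0
      by (intro add_left_mono divide_left_mono mult_pos_pos) auto
    finally show ?thesis .
  qed
  \<comment> \<open>At the endpoint \<open>s = 0\<close> of the gap both branches coincide, and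
    \<open>near\<close> controls that value; continuity extends this to small
    \<open>s\<close>.\<close>
  have "isCont (\<lambda>s. cmod (poly E (moeb g (- of_real s)))) (0::real)"
    unfolding moeb_def using Dn[of 0] by (intro continuous_intros isCont_o2[OF _ poly_isCont]) auto
  moreover have "cmod (poly E (moeb g (- of_real 0))) < \<epsilon> / 2"
    using near[of 0] a0 B0 e by simp
  ultimately have "\<forall>\<^sub>F s in at (0::real). cmod (poly E (moeb g (- of_real s))) < \<epsilon> / 2"
    unfolding isCont_def by (rule order_tendstoD)
  then obtain g0 where g0: "0 < g0" "\<And>s. s \<noteq> 0 \<Longrightarrow> \<bar>s\<bar> < g0 \<Longrightarrow> cmod (poly E (moeb g (- of_real s))) < \<epsilon> / 2"
    unfolding eventually_at by (auto simp: dist_real_def)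
  define \<rho>1 where "\<rho>1 = sqrt (1 - 4 * (min g0 \<alpha>) * Re g / (\<alpha> + cmod g)\<^sup>2)"
  have gm: "0 < min g0 \<alpha>" "min g0 \<alpha> \<le> \<alpha>" using g0 a0 by auto
  have \<rho>1: "0 \<le> \<rho>1" "\<rho>1 < 1"
    using order_trans[OF norm_ge_zero cmod_moeb_real_less(1)[OF gR gm order_refl]]
      cmod_moeb_real_less(2)[OF gR gm order_refl] unfolding \<rho>1_def by auto
  have "0 < \<epsilon> / (2 * A)" using e A(2) by simp
  then obtain m0 where m0: "\<And>m. m \<ge> m0 \<Longrightarrow> \<rho>1 ^ m \<le> \<epsilon> / (2 * A)"
    using power_small[OF \<rho>1] by blast
  have "\<forall>\<^sub>F x in at_top. sqrt (line_weight x) * (2 * A) < \<epsilon>"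
    by (rule order_tendstoD(2)[OF line_weight_tendsto]) (use e in auto)
  then obtain X1 where X1: "\<And>x. x \<ge> X1 \<Longrightarrow> sqrt (line_weight x) * (2 * A) < \<epsilon>"
    unfolding eventually_at_top_linorder by blast
  \<comment> \<open>The summand \<open>\<alpha> / 4\<close> keeps the range from
    \<open>\<alpha> / 4\<close> to \<open>G1\<close> nonempty; on it \<open>\<rho>2\<close> bounds
    the slit map of \<open>b'\<close>.\<close>
  define G1 where "G1 = sqrt \<bar>X1 - b'\<bar> + \<alpha> / 4"
  have G1: "\<alpha> / 4 \<le> G1" by (simp add: G1_def)
  define \<rho>2 where "\<rho>2 = sqrt (1 - 4 * (\<alpha> / 4) * Re (gam b') / (G1 + cmod (gam b'))\<^sup>2)"
  have a4: "0 < \<alpha> / 4" using a0 by simp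
  have \<rho>2: "0 \<le> \<rho>2" "\<rho>2 < 1"
    using order_trans[OF norm_ge_zero cmod_moeb_real_less(1)[OF Re_gam_pos a4 G1 order_refl]]
      cmod_moeb_real_less(2)[OF Re_gam_pos a4 G1 order_refl] unfolding \<rho>2_def by auto
  have "0 < \<epsilon> / (2 * A)" using e A(2) by simp
  then obtain H where H: "\<And>h. h \<ge> H \<Longrightarrow> \<rho>2 ^ h \<le> \<epsilon> / (2 * A)"
    using power_small[OF \<rho>2] by blast
  have "sqrt (line_weight x) * (cmod (poly E (slitmap b (of_real x)))
        + cmod (slitmap b (of_real x)) ^ (2 * m) * cmod (poly E (dualmap b (of_real x))))
        * cmod (slitmap b' (of_real x)) ^ h \<le> \<epsilon>" if m: "m \<ge> m0" and h: "h \<ge> H" for m h x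
  proof -
    define S where "S = cmod (poly E (slitmap b (of_real x)))
        + cmod (slitmap b (of_real x)) ^ (2 * m) * cmod (poly E (dualmap b (of_real x)))"
    have S0: "0 \<le> S" by (simp add: S_def)
    have U1: "cmod (slitmap b (of_real x)) ^ (2 * m) \<le> 1"
      by (intro power_le_one cmod_slitmap_le_1) auto
    have V1: "cmod (slitmap b' (of_real x)) ^ h \<le> 1"
      by (intro power_le_one cmod_slitmap_le_1) auto
    have S1: "S \<le> cmod (poly E (slitmap b (of_real x))) + cmod (poly E (dualmap b (of_real x)))"
      unfolding S_def using U1 by (simp add: mult_le_cancel_right1 mult_left_le_one_le)
    have reduce: "sqrt (line_weight x) * S * cmod (slitmap b' (of_real x)) ^ h \<le> sqrt (line_weight x) * S"
      using V1 S0 wt1(2)[of x] by (intro mult_left_le mult_nonneg_nonneg) auto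
    have reduce2: "sqrt (line_weight x) * S \<le> S" using wt1[of x] S0 by (simp add: mult_left_le_one_le)
    have "sqrt (line_weight x) * S * cmod (slitmap b' (of_real x)) ^ h \<le> \<epsilon>"
    proof (cases "x \<le> b")
      case True
      define y where "y = sqrt (b - x)"
      have y0: "0 \<le> y" using True by (simp add: y_def)
      have U: "slitmap b (of_real x) = moeb g (\<i> * of_real y)"
        and D: "dualmap b (of_real x) = moeb g (- (\<i> * of_real y))"
        using True by (simp_all add: slitmap_def dualmap_def csqrt_real_neg g_def y_def)
      show ?thesis
      proof (cases "x \<le> X0")
        case True
        have "S \<le> 2 * (exp (2 * M / \<alpha> * y + 2 * M / \<alpha> * cmod g) + 1)"
          using S1 far[of "\<i> * of_real y"] far[of "- (\<i> * of_real y)"] e y0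
          unfolding U D by (simp add: norm_mult)
        then have "sqrt (line_weight x) * S \<le> sqrt (line_weight x) * (2 * (exp (2 * M / \<alpha> * y + 2 * M / \<alpha> * cmod g) + 1))"
          by (intro mult_left_mono wt1)
        also have "\<dots> \<le> \<epsilon>" using X0[OF True] unfolding y_def by (simp add: algebra_simps)
        finally show ?thesis using reduce by simp
      next
        case False
        have "y \<le> sqrt \<bar>b - X0\<bar>" unfolding y_def using False True by (intro real_sqrt_le_mono) auto
        then have "cmod (\<i> * of_real y) \<le> B" using y0 a0 by (simp add: B_def norm_mult)
        then have "S \<le> \<epsilon>" using S1 near[of "\<i> * of_real y"] near[of "- (\<i> * of_real y)"] e a0
          unfolding U D by simp
        then show ?thesis using reduce reduce2 by simp
      qed
    next
      case False
      define s where "s = sqrt (x - b)"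
      have s0: "0 < s" using False by (simp add: s_def)
      have s2: "s\<^sup>2 = x - b" using False by (simp add: s_def)
      have U: "slitmap b (of_real x) = moeb g (of_real s)"
        and D: "dualmap b (of_real x) = moeb g (- of_real s)"
        using False by (simp_all add: slitmap_def dualmap_def csqrt_real_pos g_def s_def)
      show ?thesis
      proof (cases "s \<le> 3/5 * \<alpha>")
        case True
        have 1: "cmod (poly E (slitmap b (of_real x))) \<le> \<epsilon> / 4"
          unfolding U using True s0 a0 by (intro near) (auto simp: B_def intro: add_increasing)
        have "cmod (slitmap b (of_real x)) ^ (2 * m) * cmod (poly E (dualmap b (of_real x))) \<le> \<epsilon> / 2"
        proof (cases "s < g0")
          case True
          then have "cmod (poly E (dualmap b (of_real x))) \<le> \<epsilon> / 2"
            unfolding D using g0(2)[of s] s0 by simp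
          then show ?thesis using U1 by (meson mult_left_le_one_le norm_ge_zero order_trans zero_le_power)
        next
          case F: False
          have "cmod (slitmap b (of_real x)) \<le> \<rho>1"
            unfolding U \<rho>1_def using F True gm a0 gR by (intro cmod_moeb_real_less) auto
          then have "cmod (slitmap b (of_real x)) ^ (2 * m) \<le> \<rho>1 ^ (2 * m)" by (intro power_mono) auto
          also have "\<dots> \<le> \<epsilon> / (2 * A)" by (rule m0) (use m in simp)
          finally have "cmod (slitmap b (of_real x)) ^ (2 * m) * cmod (poly E (dualmap b (of_real x)))
              \<le> \<epsilon> / (2 * A) * A"
            unfolding D using e A by (intro mult_mono A Db) auto
          then show ?thesis using A by simp
        qed
        then have "S \<le> \<epsilon>" using 1 e unfolding S_def by simp
        then show ?thesis using reduce reduce2 by simp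
      next
        case F: False
        have SA: "S \<le> 2 * A"
          using S1 A(1)[OF Db[of s]] A(1)[of "moeb g (of_real s)"] L1 cmod_moeb_le_1[OF gR, of "of_real s"] s0
          unfolding U D by simp
        show ?thesis
        proof (cases "x \<ge> X1")
          case True
          have "sqrt (line_weight x) * S \<le> sqrt (line_weight x) * (2 * A)" by (intro mult_left_mono SA wt1)
          then show ?thesis using reduce X1[OF True] by simp
        next
          case F2: False
          \<comment> \<open>Here \<open>x\<close> is beyond \<open>b'\<close> by a definite amount,
            because \<open>9/25 - 1/4 \<ge> 1/16\<close>.\<close>
          have "(3/5 * \<alpha>)\<^sup>2 \<le> s\<^sup>2" using F a0 by (intro power_mono) auto
          then have "9/25 * \<alpha>\<^sup>2 \<le> x - b" unfolding s2 by (simp add: power_mult_distrib power_divide)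
          moreover have "b' \<le> b + \<alpha>\<^sup>2 / 4" using bb(2) by (simp add: \<alpha>_def g_def)
          moreover have "0 \<le> \<alpha>\<^sup>2" by simp
          ultimately have "\<alpha>\<^sup>2 / 16 \<le> x - b'" "b' \<le> x" by linarith+
          moreover have "(\<alpha> / 4)\<^sup>2 = \<alpha>\<^sup>2 / 16" by (simp add: power_divide)
          ultimately have s1: "\<alpha> / 4 \<le> sqrt (x - b')" "b' \<le> x"
            by (auto intro: real_le_rsqrt simp del: divide_le_eq_numeral1)
          have "sqrt (x - b') \<le> sqrt \<bar>X1 - b'\<bar>" using F2 s1 by (intro real_sqrt_le_mono) auto
          then have "sqrt (x - b') \<le> G1" unfolding G1_def using a0 by linarith
          then have "cmod (slitmap b' (of_real x)) \<le> \<rho>2"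
            unfolding slitmap_def csqrt_real_pos[OF s1(2)] \<rho>2_def
            using s1 a4 by (intro cmod_moeb_real_less Re_gam_pos)
          then have "cmod (slitmap b' (of_real x)) ^ h \<le> \<rho>2 ^ h" by (intro power_mono) auto
          also have "\<dots> \<le> \<epsilon> / (2 * A)" by (rule H[OF h])
          finally have "S * cmod (slitmap b' (of_real x)) ^ h \<le> (2 * A) * (\<epsilon> / (2 * A))"
            using SA S0 A by (intro mult_mono) auto
          also have "\<dots> = \<epsilon>" using A by simp
          finally show ?thesis using reduce2 mult_right_mono[OF reduce2, of "cmod (slitmap b' (of_real x)) ^ h"]
            by simp
        qed
      qed
    qed
    then show ?thesis unfolding S_def .
  qed
  then show ?thesis using E0 by blast
qed

text \<open>The polynomial \<open>E\<close> found above modulates the Faber polynomials of the arc.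
  One \<open>R\<close> serves all exponents \<open>h\<close> from the threshold on, and the gain
  \<open>\<epsilon>\<close> does not restrict \<open>b'\<close>.\<close>

lemma weighted_arc_polynomial:
  assumes bb: "b < b'" "b' \<le> b + (Re (gam b))\<^sup>2 / 4" and e: "0 < \<epsilon>" "\<epsilon> \<le> 1"
  shows "\<exists>N. \<forall>m\<ge>N. \<exists>R. degree R = m \<and> lead_coeff R = 1 \<and> (\<forall>h\<ge>N. \<forall>t. cmod t = 1 \<longrightarrow> t \<noteq> 1 \<longrightarrow>
      sqrt (line_weight (Re (cayley t))) * (cmod (slitmap b (cayley t)) ^ m * cmod (poly R t))
        * cmod (slitmap b' (cayley t)) ^ h \<le> \<epsilon> * arc_cap b ^ m)"
proof -
  obtain E m0 H where E: "poly E 0 = 1" and EB: "\<And>m h x. m \<ge> m0 \<Longrightarrow> h \<ge> H \<Longrightarrow>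
      sqrt (line_weight x) * (cmod (poly E (slitmap b (of_real x)))
        + cmod (slitmap b (of_real x)) ^ (2 * m) * cmod (poly E (dualmap b (of_real x))))
        * cmod (slitmap b' (of_real x)) ^ h \<le> \<epsilon>"
    using weighted_arc_polynomial_aux[OF assms] by meson
  define N where "N = m0 + H + degree E + 1"
  show ?thesis
  proof (rule exI[of _ N], intro allI impI)
    fix m assume m: "N \<le> m"
    obtain R where R: "degree R = m" "lead_coeff R = 1" "\<And>t. cmod t = 1 \<Longrightarrow> t \<noteq> 1 \<Longrightarrow>
      cmod (slitmap b (cayley t)) ^ m * cmod (poly R t) \<le>
        arc_cap b ^ m * (cmod (poly E (slitmap b (cayley t)))
          + cmod (slitmap b (cayley t)) ^ (2 * m) * cmod (poly E (dualmap b (cayley t))))"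
      using monic_faber_combination[OF E, of m b] m unfolding N_def by auto
    have "sqrt (line_weight (Re (cayley t))) * (cmod (slitmap b (cayley t)) ^ m * cmod (poly R t))
        * cmod (slitmap b' (cayley t)) ^ h \<le> \<epsilon> * arc_cap b ^ m" if "h \<ge> N" "cmod t = 1" "t \<noteq> 1" for h t
    proof -
      define x where "x = Re (cayley t)"
      have cx: "cayley t = of_real x" unfolding x_def by (rule cayley_real[OF that(2,3)])
      have "sqrt (line_weight x) * (cmod (slitmap b (cayley t)) ^ m * cmod (poly R t)) * cmod (slitmap b' (cayley t)) ^ h
        \<le> sqrt (line_weight x) * (arc_cap b ^ m * (cmod (poly E (slitmap b (cayley t)))
          + cmod (slitmap b (cayley t)) ^ (2 * m) * cmod (poly E (dualmap b (cayley t))))) * cmod (slitmap b' (cayley t)) ^ h"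
        using line_weight_pos[of x] by (intro mult_right_mono mult_left_mono R that) auto
      also have "\<dots> = arc_cap b ^ m * (sqrt (line_weight x) * (cmod (poly E (slitmap b (of_real x)))
          + cmod (slitmap b (of_real x)) ^ (2 * m) * cmod (poly E (dualmap b (of_real x)))) * cmod (slitmap b' (of_real x)) ^ h)"
        unfolding cx by (simp add: mult_ac)
      also have "\<dots> \<le> arc_cap b ^ m * \<epsilon>"
        using arc_cap_pos[of b] m that(1) unfolding N_def by (intro mult_left_mono EB) auto
      finally show ?thesis unfolding x_def by (simp add: mult_ac)
    qed
    then show "\<exists>R. degree R = m \<and> lead_coeff R = 1 \<and> (\<forall>h\<ge>N. \<forall>t. cmod t = 1 \<longrightarrow> t \<noteq> 1 \<longrightarrow>
      sqrt (line_weight (Re (cayley t))) * (cmod (slitmap b (cayley t)) ^ m * cmod (poly R t))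
        * cmod (slitmap b' (cayley t)) ^ h \<le> \<epsilon> * arc_cap b ^ m)"
      using R(1,2) by blast
  qed
qed

section \<open>Integrability of the logarithm of the weight\<close>

text \<open>From \<open>s * cos s \<le> sin s\<close> one gets
  \<open>s\<^sup>2 \<le> (1 + s\<^sup>2) * (sin s)\<^sup>2\<close>, and
  \<open>s\<^sup>2 \<le> 4\<close> on this interval.\<close>

lemma sq_le_5_sin_sq:
  assumes "0 \<le> s" "s \<le> pi / 2"
  shows "s\<^sup>2 \<le> 5 * (sin s)\<^sup>2"
proof -
  have c0: "0 \<le> cos s" using assms by (intro cos_ge_zero) auto
  have "sin 0 - 0 * cos 0 \<le> sin s - s * cos s"
  proof (rule DERIV_nonneg_imp_nondecreasing[OF assms(1)])
    fix x assume x: "0 \<le> x" "x \<le> s"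
    have "((\<lambda>x. sin x - x * cos x) has_real_derivative (x * sin x)) (at x)"
      by (auto intro!: derivative_eq_intros)
    moreover have "0 \<le> x * sin x" using x assms by (intro mult_nonneg_nonneg sin_ge_zero) auto
    ultimately show "\<exists>y. ((\<lambda>x. sin x - x * cos x) has_real_derivative y) (at x) \<and> 0 \<le> y" by blast
  qed
  then have "(s * cos s)\<^sup>2 \<le> (sin s)\<^sup>2" using assms c0 by (intro power_mono) auto
  then have 1: "s\<^sup>2 \<le> (sin s)\<^sup>2 + s\<^sup>2 * (sin s)\<^sup>2"
    by (simp add: power_mult_distrib cos_squared_eq algebra_simps)
  have "s\<^sup>2 \<le> 2\<^sup>2" using assms pi_less_4 by (intro power_mono) auto
  then have "s\<^sup>2 * (sin s)\<^sup>2 \<le> 4 * (sin s)\<^sup>2" by (intro mult_right_mono) auto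
  then show ?thesis using 1 by simp
qed

lemma one_plus_cayley_sq:
  assumes "cmod t = 1" "t \<noteq> 1"
  shows "1 + (Re (cayley t))\<^sup>2 = 4 / (cmod (t - 1))\<^sup>2"
proof -
  define x where "x = Re (cayley t)"
  have cx: "cayley t = of_real x" unfolding x_def by (rule cayley_real[OF assms])
  have "1 + (cayley t)\<^sup>2 = - 4 * t / (t - 1)\<^sup>2"
    using assms(2) by (simp add: cayley_def power_divide power_mult_distrib divide_simps) (simp add: power2_eq_square algebra_simps)
  then have "cmod (1 + (cayley t)\<^sup>2) = 4 / (cmod (t - 1))\<^sup>2"
    using assms by (simp add: norm_divide norm_mult norm_power)
  moreover have "1 + (cayley t)\<^sup>2 = of_real (1 + x\<^sup>2)" unfolding cx by simp
  ultimately have "cmod (of_real (1 + x\<^sup>2)) = 4 / (cmod (t - 1))\<^sup>2" by (simp only:)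
  then show ?thesis unfolding norm_of_real x_def[symmetric] by simp
qed

lemma cmod_cis_minus_1: "(cmod (cis \<theta> - 1))\<^sup>2 = 4 * (sin (\<theta> / 2))\<^sup>2"
proof -
  have "(cmod (cis \<theta> - 1))\<^sup>2 = (cos \<theta>)\<^sup>2 + (sin \<theta>)\<^sup>2 + 1 - 2 * cos \<theta>"
    by (simp only: cmod_power2) (simp add: power2_eq_square algebra_simps)
  also have "\<dots> = 2 - 2 * cos (2 * (\<theta> / 2))" by simp
  also have "\<dots> = 4 * (sin (\<theta> / 2))\<^sup>2" unfolding cos_double_sin by simp
  finally show ?thesis .
qed

text \<open>Here \<open>1 + x\<^sup>2 = 1 / (sin (\<theta> / 2))\<^sup>2\<close>. Both ends of the
  parameter interval are the point \<open>t = 1\<close>, hence two singularities, each of the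
  integrable order \<open>3/4\<close>.\<close>

lemma log_weight_bound:
  assumes "0 < \<theta>" "\<theta> < 2 * pi"
  shows "(1 + (Re (cayley (cis \<theta>)))\<^sup>2) powr (3/8) \<le>
    5 powr (3/8) * ((\<theta> / 2) powr (- 3/4) + (pi - \<theta> / 2) powr (- 3/4))"
proof -
  define s where "s = \<theta> / 2"
  have s: "0 < s" "s < pi" using assms by (auto simp: s_def)
  have sp: "0 < sin s" using s by (rule sin_gt_zero)
  have p: "cmod (cis \<theta> - 1) \<noteq> 0"
    using cmod_cis_minus_1[of \<theta>] sp by (auto simp: s_def[symmetric])
  then have e: "1 + (Re (cayley (cis \<theta>)))\<^sup>2 = 1 / (sin s)\<^sup>2"
    by (subst one_plus_cayley_sq) (auto simp: cmod_cis_minus_1 s_def)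
  have key: "(1 / (sin u)\<^sup>2) powr (3/8) \<le> 5 powr (3/8) * u powr (- 3/4)"
    if "0 < u" "u \<le> pi / 2" for u :: real
  proof -
    have su: "0 < sin u" using that by (intro sin_gt_zero) auto
    have "1 / (sin u)\<^sup>2 \<le> 5 / u\<^sup>2"
      using sq_le_5_sin_sq[of u] that su by (simp add: field_simps)
    then have "(1 / (sin u)\<^sup>2) powr (3/8) \<le> (5 / u\<^sup>2) powr (3/8)"
      by (intro powr_mono2) auto
    also have "5 / u\<^sup>2 = 5 * u powr (-2)"
      using that by (simp add: powr_minus field_simps powr_numeral)
    also have "\<dots> powr (3/8) = 5 powr (3/8) * u powr (- 3/4)"
      using that by (simp add: powr_mult powr_powr)
    finally show ?thesis .
  qed
  have "(1 / (sin s)\<^sup>2) powr (3/8) \<le> 5 powr (3/8) * (s powr (- 3/4) + (pi - s) powr (- 3/4))"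
  proof (cases "s \<le> pi / 2")
    case True
    have "5 powr (3/8) * s powr (- 3/4) \<le> 5 powr (3/8) * (s powr (- 3/4) + (pi - s) powr (- 3/4))"
      by (intro mult_left_mono) auto
    then show ?thesis using key[of s] s True by linarith
  next
    case False
    have "5 powr (3/8) * (pi - s) powr (- 3/4) \<le> 5 powr (3/8) * (s powr (- 3/4) + (pi - s) powr (- 3/4))"
      by (intro mult_left_mono) auto
    moreover have "(1 / (sin s)\<^sup>2) powr (3/8) \<le> 5 powr (3/8) * (pi - s) powr (- 3/4)"
      using key[of "pi - s"] s False by simp
    ultimately show ?thesis by linarith
  qed
  then show ?thesis unfolding e s_def .
qed

lemma integrable_log_weight:
  "integrable circle_lebesgue (\<lambda>t. ln (line_weight (Re (cayley t))))"
proof -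
  define q where "q s = indicator {0..pi} s * s powr (- 3/4)" for s :: real
  have qm: "q \<in> borel_measurable lborel" unfolding q_def[abs_def] by measurable
  have "(\<lambda>s::real. s powr (- 3/4)) integrable_on {0..pi}"
    by (rule integrable_on_powr_from_0) simp_all
  then have "(\<lambda>s::real. s powr (- 3/4)) absolutely_integrable_on {0..pi}"
    by (rule nonnegative_absolutely_integrable_1) simp
  then have "integrable lebesgue q"
    unfolding set_integrable_def q_def[abs_def] by simp
  then have q0: "integrable lborel q"
    by (simp only: integrable_completion[OF qm])
  have q1: "integrable lborel (\<lambda>\<theta>. q (0 + (1/2) * \<theta>))" "integrable lborel (\<lambda>\<theta>. q (pi + (-1/2) * \<theta>))"
    using lborel_integrable_real_affine[OF q0, of "1/2" 0] lborel_integrable_real_affine[OF q0, of "-1/2" pi]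
    by simp_all
  define p where "p \<theta> = (indicator {0..<2 * pi} \<theta> / (2 * pi)) * ln (line_weight (Re (cayley (cis \<theta>))))" for \<theta>
  have [measurable]: "cis \<in> borel_measurable borel"
    by (intro borel_measurable_continuous_onI continuous_intros) 
  have wtm [measurable]: "line_weight \<in> borel_measurable borel" unfolding line_weight_def[abs_def] by measurable
  have "integrable lborel p"
  proof (rule Bochner_Integration.integrable_bound)
    show "integrable lborel (\<lambda>\<theta>. 5 powr (3/8) / (2 * pi) * (q (0 + (1/2) * \<theta>) + q (pi + (-1/2) * \<theta>)))"
      by (intro integrable_mult_right Bochner_Integration.integrable_add q1)
    show "p \<in> borel_measurable lborel" unfolding p_def[abs_def] by measurable
    \<comment> \<open>The null set \<open>\<theta> = 0\<close>, where \<open>t = 1\<close>, is left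
      out.\<close>
    have "norm (p \<theta>) \<le> norm (5 powr (3/8) / (2 * pi) * (q (0 + (1/2) * \<theta>) + q (pi + (-1/2) * \<theta>)))"
      if "\<theta> \<noteq> 0" for \<theta>
    proof (cases "\<theta> \<in> {0..<2 * pi}")
      case True
      then have t: "0 < \<theta>" "\<theta> < 2 * pi" using that by auto
      have "norm (p \<theta>) = (1 + (Re (cayley (cis \<theta>)))\<^sup>2) powr (3/8) / (2 * pi)"
        using t by (simp add: p_def line_weight_def abs_mult)
      also have "\<dots> \<le> 5 powr (3/8) * ((\<theta> / 2) powr (- 3/4) + (pi - \<theta> / 2) powr (- 3/4)) / (2 * pi)"
        by (intro divide_right_mono log_weight_bound t) auto
      also have "\<dots> = 5 powr (3/8) / (2 * pi) * (q (0 + (1/2) * \<theta>) + q (pi + (-1/2) * \<theta>))"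
        using t by (simp add: q_def)
      finally show ?thesis by (rule order_trans) (simp only: real_norm_def abs_ge_self)
    qed (simp add: p_def)
    then show "AE \<theta> in lborel. norm (p \<theta>) \<le> norm (5 powr (3/8) / (2 * pi) * (q (0 + (1/2) * \<theta>) + q (pi + (-1/2) * \<theta>)))"
      by (intro AE_I[where N="{0}"]) auto
  qed
  then have "integrable (uniform_measure lborel {0..<2 * pi}) (\<lambda>\<theta>. ln (line_weight (Re (cayley (cis \<theta>)))))"
    unfolding uniform_eq_density by (subst integrable_density) (auto simp: p_def[abs_def])
  moreover have "(\<lambda>t. ln (line_weight (Re (cayley t)))) \<in> borel_measurable circle_borel"
    by (rule borel_imp_circle) measurable
  ultimately show ?thesis
    unfolding circle_lebesgue_def using cis_measurable_circle
    by (subst integrable_distr_eq) (simp_all cong: measurable_cong_sets)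
qed

section \<open>Assembling the measure\<close>

lemma min_monic_norm_density:
  assumes [measurable]: "\<phi> \<in> borel_measurable borel" and "\<And>t. 0 \<le> \<phi> t"
  shows "min_monic_norm n (density circle_lebesgue (\<lambda>t. ennreal (\<phi> t))) =
    sqrt (INF q. LINT t|circle_lebesgue. \<phi> t * (cmod (t ^ n + (\<Sum>k<n. q k * t ^ k)))\<^sup>2)"
proof -
  have "(LINT t|density circle_lebesgue (\<lambda>t. ennreal (\<phi> t)). (cmod (t ^ n + (\<Sum>k<n. q k * t ^ k)))\<^sup>2)
    = (LINT t|circle_lebesgue. \<phi> t * (cmod (t ^ n + (\<Sum>k<n. q k * t ^ k)))\<^sup>2)" for q :: "nat \<Rightarrow> complex"
  proof (subst integral_density)
    show "(\<lambda>t. (cmod (t ^ n + (\<Sum>k<n. q k * t ^ k)))\<^sup>2) \<in> borel_measurable circle_lebesgue"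
      by (rule borel_imp_circle_lebesgue) measurable
    show "\<phi> \<in> borel_measurable circle_lebesgue" by (rule borel_imp_circle_lebesgue) fact
  qed (use assms in auto)
  then show ?thesis unfolding min_monic_norm_def by simp
qed

text \<open>The normalised measure has mass \<open>1\<close>, so a weighted supremum bound for one
  monic polynomial bounds its norm.\<close>

lemma min_monic_norm_le:
  assumes [measurable]: "\<phi> \<in> borel_measurable borel" and nn: "\<And>t. 0 \<le> \<phi> t" and K: "0 \<le> K"
    and R: "degree R = n" "lead_coeff R = 1"
    and bound: "\<And>t. cmod t = 1 \<Longrightarrow> t \<noteq> 1 \<Longrightarrow> sqrt (\<phi> t) * cmod (poly R t) \<le> K"
  shows "min_monic_norm n (density circle_lebesgue (\<lambda>t. ennreal (\<phi> t))) \<le> K"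
proof -
  interpret prob_space circle_lebesgue by (rule prob_space_circle_lebesgue)
  have R_eq: "poly R t = t ^ n + (\<Sum>k<n. coeff R k * t ^ k)" for t
    unfolding poly_altdef R(1) using R by (simp add: lessThan_Suc_atMost[symmetric])
  have AE1: "AE t in circle_lebesgue. cmod t = 1 \<and> t \<noteq> 1"
    using AE_circle_ne_1 AE_space by eventually_elim (simp add: space_circle_lebesgue)
  have AEb: "AE t in circle_lebesgue. norm (\<phi> t * (cmod (poly R t))\<^sup>2) \<le> K\<^sup>2"
    using AE1
  proof eventually_elim
    case (elim t)
    have "(sqrt (\<phi> t) * cmod (poly R t))\<^sup>2 \<le> K\<^sup>2"
      using bound[of t] elim nn[of t] by (intro power_mono mult_nonneg_nonneg) auto
    then show ?case using nn[of t] by (simp add: power_mult_distrib)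
  qed
  have m: "(\<lambda>t. \<phi> t * (cmod (poly R t))\<^sup>2) \<in> borel_measurable circle_lebesgue"
    unfolding R_eq by (rule borel_imp_circle_lebesgue) measurable
  have int: "integrable circle_lebesgue (\<lambda>t. \<phi> t * (cmod (poly R t))\<^sup>2)"
    by (rule integrable_const_bound[OF AEb m])
  have "(LINT t|circle_lebesgue. \<phi> t * (cmod (poly R t))\<^sup>2) \<le> (LINT t|circle_lebesgue. K\<^sup>2)"
    by (rule integral_mono_AE[OF int]) (use AEb in auto)
  then have le: "(LINT t|circle_lebesgue. \<phi> t * (cmod (poly R t))\<^sup>2) \<le> K\<^sup>2" by (simp add: prob_space)
  have "(INF q. LINT t|circle_lebesgue. \<phi> t * (cmod (t ^ n + (\<Sum>k<n. q k * t ^ k)))\<^sup>2)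
      \<le> (LINT t|circle_lebesgue. \<phi> t * (cmod (t ^ n + (\<Sum>k<n. coeff R k * t ^ k)))\<^sup>2)"
    by (rule cINF_lower) (auto intro!: bdd_belowI[where m=0] integral_nonneg_AE mult_nonneg_nonneg nn)
  also have "\<dots> \<le> K\<^sup>2" using le unfolding R_eq .
  finally show ?thesis
    unfolding min_monic_norm_density[OF assms(1) nn] using K by (intro real_le_lsqrt) auto
qed

lemma min_monic_norm_ge:
  assumes [measurable]: "\<phi> \<in> borel_measurable borel" and nn: "\<And>t. 0 \<le> \<phi> t" and K: "0 \<le> K"
    and bound: "\<And>q. K\<^sup>2 \<le> (LINT t|circle_lebesgue. \<phi> t * (cmod (t ^ n + (\<Sum>k<n. q k * t ^ k)))\<^sup>2)"
  shows "K \<le> min_monic_norm n (density circle_lebesgue (\<lambda>t. ennreal (\<phi> t)))"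
  unfolding min_monic_norm_density[OF assms(1) nn]
  by (intro real_le_rsqrt cINF_greatest bound) auto

lemma min_monic_norm_nonneg: "0 \<le> min_monic_norm n \<rho>"
  unfolding min_monic_norm_def
  by (intro real_sqrt_ge_zero cINF_greatest integral_nonneg_AE) auto

text \<open>The steps of this sequence satisfy the hypothesis of \<open>weighted_arc_polynomial\<close>.\<close>

definition gap_end :: "nat \<Rightarrow> real" where
  "gap_end j = sqrt (real j) / 8"

lemma gap_end_strict_mono: "i < j \<Longrightarrow> gap_end i < gap_end j"
  by (simp add: gap_end_def)

lemma gap_end_mono: "i \<le> j \<Longrightarrow> gap_end i \<le> gap_end j"
  by (simp add: gap_end_def)

lemma gap_end_at_top: "filterlim gap_end at_top sequentially"
  unfolding gap_end_def by real_asymp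

text \<open>Let \<open>b = gap_end j\<close> and \<open>p = (Re (gam b))\<^sup>2\<close>. Then
  \<open>p * (p + b) = 1/4\<close>, so \<open>p\<close> is about \<open>1 / (4 * b)\<close>, which
  permits steps of order \<open>1 / b\<close> and thus growth like a square root. The step is
  exactly \<open>q / 4\<close> with \<open>q\<close> as below, and \<open>q \<le> p\<close> follows
  since \<open>q * (q + b) \<le> 1/4\<close>.\<close>

lemma gap_end_step: "gap_end (Suc j) \<le> gap_end j + (Re (gam (gap_end j)))\<^sup>2 / 4"
proof -
  define p where "p = (Re (gam (gap_end j)))\<^sup>2"
  define a where "a = sqrt (real j)"
  define c where "c = sqrt (real (Suc j))"
  have ac: "0 \<le> a" "1 \<le> c" "c\<^sup>2 = a\<^sup>2 + 1" by (auto simp: a_def c_def)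
  have Im2: "(Im (gam (gap_end j)))\<^sup>2 = p + a / 8"
    using Re_sq_gam[of "gap_end j"] by (simp add: p_def gap_end_def a_def)
  have "4 * (p * (p + a / 8)) = (2 * Re (gam (gap_end j)) * Im (gam (gap_end j)))\<^sup>2"
    using Im2 by (simp add: power_mult_distrib p_def[symmetric])
  then have pp: "p * (p + a / 8) = 1 / 4" unfolding Re_Im_gam by simp
  have p0: "0 \<le> p" by (simp add: p_def)
  define q where "q = 1 / (2 * (a + c))"
  have q0: "0 < q" using ac by (simp add: q_def)
  have qac: "q * (a + c) = 1 / 2" using ac by (simp add: q_def)
  have "q \<le> p"
  proof (rule ccontr)
    assume "\<not> q \<le> p"
    then have "p * (p + a / 8) < q * (q + a / 8)"
      using p0 q0 ac by (intro mult_strict_mono) auto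
    also have "\<dots> \<le> q * (q * c + a / 2 * (q * (a + c)))"
    proof -
      have "q * 1 \<le> q * c" using ac q0 by (intro mult_left_mono) auto
      moreover have "a / 8 \<le> a / 2 * (q * (a + c))" unfolding qac using ac by simp
      ultimately have "q + a / 8 \<le> q * c + a / 2 * (q * (a + c))" by linarith
      then show ?thesis using q0 by (intro mult_left_mono) auto
    qed
    also have "\<dots> \<le> 1 / 4"
    proof -
      have "q * 1 \<le> q * (a + c)" using q0 ac by (intro mult_left_mono) auto
      then have q12: "q \<le> 1 / 2" unfolding qac by simp
      have "q * (q * c + a / 2 * (q * (a + c))) = q * (q * c) + q * a / 4"
        unfolding qac by (simp add: distrib_left)
      also have "\<dots> \<le> 1 / 2 * (q * c) + q * a / 2" using q12 q0 ac
        by (intro add_mono mult_right_mono) auto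
      also have "\<dots> = 1 / 2 * (q * (a + c))" by (simp add: algebra_simps)
      finally show ?thesis unfolding qac by simp
    qed
    finally show False using pp by simp
  qed
  moreover have "c / 8 - a / 8 = q / 4"
  proof -
    have "c - a = 1 / (a + c)"
      using ac by (simp add: field_simps power2_eq_square)
    then have "(c - a) / 8 = q / 4" unfolding q_def by simp
    then show ?thesis by (simp add: diff_divide_distrib)
  qed
  moreover have "gap_end j = a / 8" "gap_end (Suc j) = c / 8" by (simp_all only: gap_end_def a_def c_def)
  ultimately show ?thesis unfolding p_def[symmetric] by linarith
qed

section \<open>The density built from the slit maps\<close>

context
  fixes h :: "nat \<Rightarrow> nat"
begin

text \<open>The exponents are half of those in the density, since norms involve the square root of
  the density.\<close>

definition slit_prod :: "nat \<Rightarrow> complex \<Rightarrow> real" where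
  "slit_prod n t = (\<Prod>i<n. cmod (slitmap (gap_end i) (cayley t)) ^ (2 * h i))"

definition slit_density :: "complex \<Rightarrow> real" where
  "slit_density t = lim (\<lambda>n. (slit_prod n t)\<^sup>2)"

lemma slit_prod_measurable [measurable]: "slit_prod n \<in> borel_measurable borel"
  unfolding slit_prod_def[abs_def] by measurable

lemma slit_density_measurable [measurable]: "slit_density \<in> borel_measurable borel"
  unfolding slit_density_def[abs_def] by measurable

lemma slit_prod_bounds: "0 \<le> slit_prod n t" "slit_prod n t \<le> 1"
  unfolding slit_prod_def
  by (auto intro!: prod_nonneg prod_le_1 power_le_one cmod_slitmap_le_1)

lemma slit_prod_antimono: "m \<le> n \<Longrightarrow> slit_prod n t \<le> slit_prod m t"
proof (induction n rule: dec_induct)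
  case (step n)
  have "slit_prod (Suc n) t = slit_prod n t * cmod (slitmap (gap_end n) (cayley t)) ^ (2 * h n)"
    by (simp add: slit_prod_def)
  also have "\<dots> \<le> slit_prod n t"
    by (intro mult_left_le power_le_one cmod_slitmap_le_1 slit_prod_bounds) auto
  finally show ?case using step by simp
qed simp

text \<open>As soon as \<open>gap_end n\<close> is at least \<open>x\<close>, the point lies on the
  arc of the \<open>n\<close>-th slit map, whose modulus is \<open>1\<close> there. The partial
  products are thus eventually constant at every \<open>t \<noteq> 1\<close>.\<close>

lemma slit_density_eq:
  assumes t: "cmod t = 1" "t \<noteq> 1" and j: "Re (cayley t) \<le> gap_end j"
  shows "slit_density t = (slit_prod j t)\<^sup>2"
proof -
  have "slit_prod n t = slit_prod j t" if "j \<le> n" for n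
    using that
  proof (induction n rule: dec_induct)
    case (step n)
    have "Re (cayley t) \<le> gap_end n" using j gap_end_mono[OF step(1)] by simp
    then have "cmod (slitmap (gap_end n) (cayley t)) = 1"
      by (subst cayley_real[OF t]) (rule cmod_slitmap_eq_1)
    then show ?case using step by (simp add: slit_prod_def)
  qed simp
  then have "\<forall>\<^sub>F n in sequentially. (slit_prod n t)\<^sup>2 = (slit_prod j t)\<^sup>2"
    unfolding eventually_sequentially by metis
  then show ?thesis unfolding slit_density_def
    by (intro limI tendsto_eventually)
qed

lemma ex_gap_end_ge: "\<exists>j. x \<le> gap_end j"
proof -
  have "\<forall>\<^sub>F j in sequentially. x \<le> gap_end j" using gap_end_at_top by (simp add: filterlim_at_top)
  then show ?thesis by (auto simp: eventually_sequentially)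
qed

lemma slit_density_le:
  assumes t: "cmod t = 1" "t \<noteq> 1"
  shows "slit_density t \<le> (slit_prod n t)\<^sup>2"
proof -
  obtain j where "Re (cayley t) \<le> gap_end j" using ex_gap_end_ge by blast
  then have j: "Re (cayley t) \<le> gap_end (max j n)" using gap_end_mono[of j "max j n"] by simp
  show ?thesis unfolding slit_density_eq[OF t j]
    by (intro power_mono slit_prod_antimono slit_prod_bounds) auto
qed

lemma slit_density_pos:
  assumes t: "cmod t = 1" "t \<noteq> 1"
  shows "0 < slit_density t"
proof -
  obtain j where j: "Re (cayley t) \<le> gap_end j" using ex_gap_end_ge by blast
  have "slitmap b (cayley t) \<noteq> 0" for b by (rule slitmap_dualmap(2)[OF t])
  then have "0 < slit_prod j t" unfolding slit_prod_def by (intro prod_pos) auto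
  then show ?thesis unfolding slit_density_eq[OF t j] by simp
qed

lemma slit_density_bounds: "cmod t = 1 \<Longrightarrow> t \<noteq> 1 \<Longrightarrow> 0 \<le> slit_density t \<and> slit_density t \<le> 1"
  using slit_density_pos[of t] slit_density_le[of t 0] by (simp add: slit_prod_def)

text \<open>The truncation only repairs the exceptional points, where \<open>lim\<close> is not controlled.\<close>

definition dens :: "complex \<Rightarrow> real" where
  "dens t = max 0 (min 1 (slit_density t)) / 2"

lemma dens_measurable [measurable]: "dens \<in> borel_measurable borel"
  unfolding dens_def[abs_def] by measurable

lemma dens_bounds: "0 \<le> dens t" "dens t < 1"
  by (auto simp: dens_def)

lemma dens_eq: "cmod t = 1 \<Longrightarrow> t \<noteq> 1 \<Longrightarrow> dens t = slit_density t / 2"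
  using slit_density_bounds[of t] by (simp add: dens_def)

text \<open>The integral bound over the arc \<open>x \<le> gap_end j\<close> is applied with
  exponents \<open>2 * h i\<close> for \<open>i < j\<close> and \<open>l\<close> for
  \<open>j\<close>. On this arc the \<open>j\<close>-th slit map has modulus \<open>1\<close>, so
  the remaining product is the square root of \<open>2 * dens\<close>. The extra capacity in
  \<open>Suc l\<close> comes from the additional factor for \<open>c\<close>.\<close>

lemma min_monic_norm_dens_ge:
  assumes l: "l \<le> 2 * h j"
  shows "(\<Prod>i<j. arc_cap (gap_end i) ^ (2 * h i)) * arc_cap (gap_end j) ^ Suc l / 4 \<le>
    min_monic_norm ((\<Sum>i<j. 2 * h i) + l) (density circle_lebesgue (\<lambda>t. ennreal (dens t)))"
proof (rule min_monic_norm_ge)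
  show "dens \<in> borel_measurable borel" by measurable
  show "0 \<le> dens t" for t by (rule dens_bounds)
  show "0 \<le> (\<Prod>i<j. arc_cap (gap_end i) ^ (2 * h i)) * arc_cap (gap_end j) ^ Suc l / 4"
    by (intro divide_nonneg_pos mult_nonneg_nonneg prod_nonneg ballI zero_le_power less_imp_le[OF arc_cap_pos]) simp
  fix q :: "nat \<Rightarrow> complex"
  interpret prob_space circle_lebesgue by (rule prob_space_circle_lebesgue)
  define n where "n = (\<Sum>i<j. 2 * h i) + l"
  define lf where "lf i = (if i < j then 2 * h i else l)" for i
  define P where "P t = t ^ n + (\<Sum>k<n. q k * t ^ k)" for t
  define d where "d t = (if Re (cayley t) \<le> gap_end j
       then 2 * (cmod (P t) * (\<Prod>i\<in>{..<Suc j}. cmod (slitmap (gap_end i) (cayley t)) ^ lf i)) else 0)" for t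
  define A where "A = (\<Prod>i<j. arc_cap (gap_end i) ^ (2 * h i)) * arc_cap (gap_end j) ^ Suc l"
  have nl: "n = sum lf {..<Suc j}" by (simp add: n_def lf_def)
  have A_eq: "A = (\<Prod>i\<in>{..<Suc j}. arc_cap (gap_end i) ^ lf i) * arc_cap (gap_end j)"
    by (simp add: A_def lf_def mult_ac)
  have A0: "0 \<le> A" unfolding A_def
    by (intro mult_nonneg_nonneg prod_nonneg ballI zero_le_power less_imp_le[OF arc_cap_pos])
  have 1: "A \<le> (LINT t|circle_lebesgue. d t)"
    unfolding A_eq d_def P_def by (rule outer_value_le_integral) (auto simp: nl gap_end_mono)
  define K where "K = 1 + (\<Sum>k<n. cmod (q k))"
  have Pb: "cmod (P v) \<le> K" if "cmod v = 1" for v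
  proof -
    have "cmod (P v) \<le> cmod (v ^ n) + (\<Sum>k<n. cmod (q k * v ^ k))"
      unfolding P_def by (intro norm_triangle_le add_left_mono norm_sum)
    then show ?thesis using that by (simp add: K_def norm_mult norm_power)
  qed
  have Pr: "0 \<le> (\<Prod>i\<in>{..<Suc j}. cmod (slitmap (gap_end i) (cayley t)) ^ lf i)"
    "(\<Prod>i\<in>{..<Suc j}. cmod (slitmap (gap_end i) (cayley t)) ^ lf i) \<le> 1" for t
    by (auto intro!: prod_nonneg prod_le_1 mult_le_one power_le_one cmod_slitmap_le_1 simp del: lessThan_Suc prod.lessThan_Suc)
  have md: "d \<in> borel_measurable borel" unfolding d_def[abs_def] P_def by measurable
  have db: "\<bar>d t\<bar> \<le> 2 * K" if "t \<in> space circle_lebesgue" for t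
  proof -
    have tc: "cmod t = 1" using that by (simp add: space_circle_lebesgue)
    have K0: "0 \<le> K" using Pb[OF tc] norm_ge_zero order_trans by blast
    have "cmod (P t) * (\<Prod>i\<in>{..<Suc j}. cmod (slitmap (gap_end i) (cayley t)) ^ lf i) \<le> K * 1"
      using K0 by (intro mult_mono Pb tc Pr) auto
    moreover have "0 \<le> cmod (P t) * (\<Prod>i\<in>{..<Suc j}. cmod (slitmap (gap_end i) (cayley t)) ^ lf i)"
      by (intro mult_nonneg_nonneg Pr) auto
    ultimately show ?thesis using K0 by (simp add: d_def del: prod.lessThan_Suc)
  qed
  have "A\<^sup>2 \<le> (LINT t|circle_lebesgue. d t)\<^sup>2" using 1 A0 by (intro power_mono)
  also have "\<dots> \<le> (LINT t|circle_lebesgue. (d t)\<^sup>2)"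
    by (rule integral_square_ge[OF prob_space_circle_lebesgue borel_imp_circle_lebesgue[OF md] db])
  \<comment> \<open>The constant \<open>8\<close> is \<open>2\<^sup>2\<close> from \<open>d\<close>
    times \<open>2\<close> from \<open>dens = slit_density / 2\<close>.\<close>
  also have "\<dots> \<le> (LINT t|circle_lebesgue. 8 * (dens t * (cmod (P t))\<^sup>2))"
  proof (rule integral_mono_AE)
    have AE1: "AE t in circle_lebesgue. cmod t = 1 \<and> t \<noteq> 1"
      using AE_circle_ne_1 AE_space by eventually_elim (simp add: space_circle_lebesgue)
    have AEd: "AE t in circle_lebesgue. norm ((d t)\<^sup>2) \<le> (2 * K)\<^sup>2"
    proof (rule AE_I2)
      fix t assume "t \<in> space circle_lebesgue"
      then have "\<bar>d t\<bar>\<^sup>2 \<le> (2 * K)\<^sup>2" by (intro power_mono db) auto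
      then show "norm ((d t)\<^sup>2) \<le> (2 * K)\<^sup>2" by simp
    qed
    show "integrable circle_lebesgue (\<lambda>t. (d t)\<^sup>2)"
      using md by (intro integrable_const_bound[OF AEd] borel_imp_circle_lebesgue) measurable
    have AEp: "AE t in circle_lebesgue. norm (8 * (dens t * (cmod (P t))\<^sup>2)) \<le> 8 * (1 * K\<^sup>2)"
      using AE1
    proof eventually_elim
      case (elim t)
      have "dens t * (cmod (P t))\<^sup>2 \<le> 1 * K\<^sup>2"
        using elim dens_bounds[of t] by (intro mult_mono power_mono Pb) auto
      then show ?case using dens_bounds[of t] by simp
    qed
    show "integrable circle_lebesgue (\<lambda>t. 8 * (dens t * (cmod (P t))\<^sup>2))"
      unfolding P_def
      by (rule integrable_const_bound[OF AEp[unfolded P_def]]) (rule borel_imp_circle_lebesgue, measurable)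
    show "AE t in circle_lebesgue. (d t)\<^sup>2 \<le> 8 * (dens t * (cmod (P t))\<^sup>2)"
      using AE1
    proof eventually_elim
      case (elim t)
      then have t: "cmod t = 1" "t \<noteq> 1" by auto
      show ?case
      proof (cases "Re (cayley t) \<le> gap_end j")
        case True
        have "cmod (slitmap (gap_end j) (cayley t)) = 1"
          using True by (subst cayley_real[OF t]) (rule cmod_slitmap_eq_1)
        then have "(\<Prod>i\<in>{..<Suc j}. cmod (slitmap (gap_end i) (cayley t)) ^ lf i) = slit_prod j t"
          by (simp add: slit_prod_def lf_def)
        then have "(d t)\<^sup>2 = 4 * ((slit_prod j t)\<^sup>2 * (cmod (P t))\<^sup>2)"
          using True by (simp add: d_def power_mult_distrib mult_ac)
        also have "(slit_prod j t)\<^sup>2 = 2 * dens t" by (simp add: dens_eq[OF t] slit_density_eq[OF t True])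
        finally show ?thesis by simp
      next
        case False
        then show ?thesis using dens_bounds[of t] by (simp add: d_def)
      qed
    qed
  qed
  also have "\<dots> = 8 * (LINT t|circle_lebesgue. dens t * (cmod (P t))\<^sup>2)" by simp
  \<comment> \<open>\<open>1/8\<close> is lowered to the square number \<open>1/16\<close>, which
    gives the factor \<open>1/4\<close> in the claim.\<close>
  finally have "A\<^sup>2 / 16 \<le> (LINT t|circle_lebesgue. dens t * (cmod (P t))\<^sup>2)"
    using zero_le_power2[of A] by linarith
  then show "((\<Prod>i<j. arc_cap (gap_end i) ^ (2 * h i)) * arc_cap (gap_end j) ^ Suc l / 4)\<^sup>2
    \<le> (LINT t|circle_lebesgue. dens t *
        (cmod (t ^ ((\<Sum>i<j. 2 * h i) + l) + (\<Sum>k<(\<Sum>i<j. 2 * h i) + l. q k * t ^ k)))\<^sup>2)"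
    unfolding P_def n_def A_def by (simp add: power_divide)
qed

lemma degree_lead_coeff_prod:
  fixes p :: "nat \<Rightarrow> complex poly"
  assumes "\<And>i. i < j \<Longrightarrow> degree (p i) = m i \<and> lead_coeff (p i) = 1"
  shows "degree (\<Prod>i<j. p i) = (\<Sum>i<j. m i) \<and> lead_coeff (\<Prod>i<j. p i) = 1"
  using assms
proof (induction j)
  case (Suc j)
  have "degree (\<Prod>i<j. p i) = (\<Sum>i<j. m i) \<and> lead_coeff (\<Prod>i<j. p i) = 1"
    using Suc.IH Suc.prems less_SucI by blast
  then have IH: "degree (\<Prod>i<j. p i) = (\<Sum>i<j. m i)" "lead_coeff (\<Prod>i<j. p i) = 1"
    by blast+
  have pj: "degree (p j) = m j" "lead_coeff (p j) = 1" using Suc(2)[of j] by auto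
  have "(\<Prod>i<j. p i) \<noteq> 0" "p j \<noteq> 0"
    using IH(2) pj(2) by (metis coeff_0 zero_neq_one)+
  then have "degree ((\<Prod>i<j. p i) * p j) = (\<Sum>i<j. m i) + m j"
    using degree_mult_eq[of "\<Prod>i<j. p i" "p j"] IH(1) pj(1) by metis
  moreover have "lead_coeff ((\<Prod>i<j. p i) * p j) = 1"
    unfolding lead_coeff_mult IH(2) pj(2) by simp
  ultimately show ?case unfolding prod.lessThan_Suc sum.lessThan_Suc by blast
qed simp

text \<open>The test polynomial is the product of Chebyshev polynomials of degree
  \<open>2 * h i\<close> for \<open>i < j\<close>, of \<open>R\<close>, and of Chebyshev polynomials
  of degree \<open>a\<close> and \<open>c\<close> for the arcs \<open>j\<close> and
  \<open>Suc j\<close>. The \<open>j + 2\<close> Chebyshev factors cost a factor \<open>2\<close>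
  each, and \<open>R\<close> gains \<open>\<epsilon>\<close>.\<close>

lemma min_monic_norm_weighted_le:
  assumes a: "a \<le> h j" and c: "c \<le> h (Suc j)" and e: "0 \<le> \<epsilon>"
    and R: "degree R = h j" "lead_coeff R = 1"
    and RB: "\<And>k t. h (Suc j) \<le> k \<Longrightarrow> cmod t = 1 \<Longrightarrow> t \<noteq> 1 \<Longrightarrow>
      sqrt (line_weight (Re (cayley t))) * (cmod (slitmap (gap_end j) (cayley t)) ^ h j * cmod (poly R t))
        * cmod (slitmap (gap_end (Suc j)) (cayley t)) ^ k \<le> \<epsilon> * arc_cap (gap_end j) ^ h j"
  shows "min_monic_norm ((\<Sum>i<j. 2 * h i) + h j + a + c)
      (density circle_lebesgue (\<lambda>t. ennreal (dens t * line_weight (Re (cayley t))))) \<le>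
    2 ^ (j + 2) * \<epsilon> * ((\<Prod>i<j. arc_cap (gap_end i) ^ (2 * h i)) * arc_cap (gap_end j) ^ (h j + a) * arc_cap (gap_end (Suc j)) ^ c)"
proof -
  have "\<forall>i m. \<exists>T. degree T = m \<and> lead_coeff T = 1 \<and>
    (\<forall>t. cmod t = 1 \<longrightarrow> t \<noteq> 1 \<longrightarrow>
      cmod (slitmap (gap_end i) (cayley t)) ^ m * cmod (poly T t) \<le> 2 * arc_cap (gap_end i) ^ m)"
    using chebyshev_arc by blast
  then obtain T where T: "\<And>i m. degree (T i m) = m" "\<And>i m. lead_coeff (T i m) = 1"
    "\<And>i m t. cmod t = 1 \<Longrightarrow> t \<noteq> 1 \<Longrightarrow>
      cmod (slitmap (gap_end i) (cayley t)) ^ m * cmod (poly (T i m) t) \<le> 2 * arc_cap (gap_end i) ^ m"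
    by metis
  define P0 where "P0 = (\<Prod>i<j. T i (2 * h i))"
  define P where "P = P0 * (R * (T j a * T (Suc j) c))"
  have P0: "degree P0 = (\<Sum>i<j. 2 * h i)" "lead_coeff P0 = 1"
    using degree_lead_coeff_prod[of j "\<lambda>i. T i (2 * h i)" "\<lambda>i. 2 * h i"] T unfolding P0_def by auto
  have nz: "P0 \<noteq> 0" "R \<noteq> 0" "T i m \<noteq> 0" for i m
    using P0(2) R(2) T(2)[of i m] by auto
  have degP: "degree P = (\<Sum>i<j. 2 * h i) + h j + a + c"
    unfolding P_def using nz P0 R T by (simp add: degree_mult_eq)
  have leadP: "lead_coeff P = 1"
    unfolding P_def lead_coeff_mult using P0 R T by simp
  have kp: "0 \<le> arc_cap b" for b by (rule less_imp_le[OF arc_cap_pos])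
  show ?thesis
  proof (rule min_monic_norm_le[OF _ _ _ degP leadP])
    show "(\<lambda>t. dens t * line_weight (Re (cayley t))) \<in> borel_measurable borel"
      unfolding line_weight_def by measurable
    show "0 \<le> dens t * line_weight (Re (cayley t))" for t
      using dens_bounds line_weight_pos by (intro mult_nonneg_nonneg) (auto intro: less_imp_le)
    show "0 \<le> 2 ^ (j + 2) * \<epsilon> * ((\<Prod>i<j. arc_cap (gap_end i) ^ (2 * h i)) * arc_cap (gap_end j) ^ (h j + a) * arc_cap (gap_end (Suc j)) ^ c)"
      using e kp by (intro mult_nonneg_nonneg prod_nonneg zero_le_power) auto
    fix t assume t: "cmod t = 1" "t \<noteq> 1"
    define U where "U i = cmod (slitmap (gap_end i) (cayley t))" for i
    have U: "0 \<le> U i" "U i \<le> 1" for i unfolding U_def using cmod_slitmap_le_1 by auto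
    define W where "W = sqrt (line_weight (Re (cayley t)))"
    have W0: "0 \<le> W" unfolding W_def using line_weight_pos[of "Re (cayley t)"] by simp
    have "dens t \<le> (slit_prod (j + 2) t)\<^sup>2"
      using slit_density_le[OF t, of "j + 2"] slit_density_pos[OF t] dens_eq[OF t] by simp
    then have "sqrt (dens t) \<le> slit_prod (j + 2) t"
      using slit_prod_bounds by (intro real_le_lsqrt) auto
    also have "slit_prod (j + 2) t = (\<Prod>i<j. U i ^ (2 * h i)) * U j ^ (2 * h j) * U (Suc j) ^ (2 * h (Suc j))"
      by (simp add: slit_prod_def U_def)
    \<comment> \<open>Half of the exponent \<open>2 * h j\<close> goes to \<open>R\<close>, the
      other half pays for degree \<open>a\<close>. Likewise half of \<open>2 * h (Suc j)\<close>
      damps \<open>R\<close> inside the gap and the other half pays for degree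
      \<open>c\<close>.\<close>
    also have "\<dots> \<le> (\<Prod>i<j. U i ^ (2 * h i)) * (U j ^ h j * U j ^ a) * (U (Suc j) ^ h (Suc j) * U (Suc j) ^ c)"
      using U a c unfolding power_add[symmetric]
      by (intro mult_mono order_refl power_decreasing mult_nonneg_nonneg prod_nonneg zero_le_power) auto
    finally have D: "sqrt (dens t) \<le> \<dots>" .
    have X: "(\<Prod>i<j. U i ^ (2 * h i) * cmod (poly (T i (2 * h i)) t)) \<le> (\<Prod>i<j. 2 * arc_cap (gap_end i) ^ (2 * h i))"
      unfolding U_def using T(3)[OF t] by (intro prod_mono) auto
    have "sqrt (dens t * line_weight (Re (cayley t))) * cmod (poly P t)
       = sqrt (dens t) * (W * cmod (poly P t))" by (simp add: real_sqrt_mult W_def)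
    also have "\<dots> \<le> ((\<Prod>i<j. U i ^ (2 * h i)) * (U j ^ h j * U j ^ a) * (U (Suc j) ^ h (Suc j) * U (Suc j) ^ c))
        * (W * cmod (poly P t))"
      using D W0 by (intro mult_right_mono) auto
    also have "\<dots> = (\<Prod>i<j. U i ^ (2 * h i) * cmod (poly (T i (2 * h i)) t))
        * ((W * (U j ^ h j * cmod (poly R t)) * U (Suc j) ^ h (Suc j))
        * ((U j ^ a * cmod (poly (T j a) t)) * (U (Suc j) ^ c * cmod (poly (T (Suc j) c) t))))"
      by (simp add: P_def P0_def poly_prod norm_mult prod_norm[symmetric] prod.distrib mult_ac)
    also have "\<dots> \<le> (\<Prod>i<j. 2 * arc_cap (gap_end i) ^ (2 * h i)) *
        ((\<epsilon> * arc_cap (gap_end j) ^ h j) * ((2 * arc_cap (gap_end j) ^ a) * (2 * arc_cap (gap_end (Suc j)) ^ c)))"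
    proof -
      have 1: "W * (U j ^ h j * cmod (poly R t)) * U (Suc j) ^ h (Suc j) \<le> \<epsilon> * arc_cap (gap_end j) ^ h j"
        unfolding U_def W_def by (rule RB[OF order_refl t])
      have 2: "U i ^ m * cmod (poly (T i m) t) \<le> 2 * arc_cap (gap_end i) ^ m" for i m
        unfolding U_def by (rule T(3)[OF t])
      have n: "0 \<le> U i ^ m * cmod (poly (T i m) t)" for i m using U(1)[of i] by simp
      have n1: "0 \<le> W * (U j ^ h j * cmod (poly R t)) * U (Suc j) ^ h (Suc j)"
        using W0 U(1) by simp
      have n2: "0 \<le> (\<Prod>i<j. 2 * arc_cap (gap_end i) ^ (2 * h i))" using kp by (intro prod_nonneg) simp
      have 3: "(U j ^ a * cmod (poly (T j a) t)) * (U (Suc j) ^ c * cmod (poly (T (Suc j) c) t))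
          \<le> (2 * arc_cap (gap_end j) ^ a) * (2 * arc_cap (gap_end (Suc j)) ^ c)"
        by (rule mult_mono[OF 2 2 order_trans[OF n 2] n])
      have n3: "0 \<le> (U j ^ a * cmod (poly (T j a) t)) * (U (Suc j) ^ c * cmod (poly (T (Suc j) c) t))"
        by (intro mult_nonneg_nonneg n)
      show ?thesis
        by (rule mult_mono[OF X mult_mono[OF 1 3 order_trans[OF n1 1] n3] n2 mult_nonneg_nonneg[OF n1 n3]])
    qed
    also have "\<dots> = 2 ^ (j + 2) * \<epsilon> * ((\<Prod>i<j. arc_cap (gap_end i) ^ (2 * h i)) * arc_cap (gap_end j) ^ (h j + a) * arc_cap (gap_end (Suc j)) ^ c)"
      by (simp add: prod.distrib power_add mult_ac)
    finally show "sqrt (dens t * line_weight (Re (cayley t))) * cmod (poly P t) \<le> \<dots>" .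
  qed
qed

end

section \<open>Choice of the scales and conclusion\<close>

lemma ex_level:
  fixes N :: "nat \<Rightarrow> nat"
  assumes N: "\<And>j. N j < N (Suc j)" and n: "N J \<le> n"
  shows "\<exists>j\<ge>J. N j \<le> n \<and> n < N (Suc j)"
proof -
  have mono: "strict_mono N" using N by (simp add: strict_mono_Suc_iff)
  have le: "j \<le> n" if "N j \<le> n" for j
    using strict_mono_imp_increasing[OF mono, of j] that by simp
  define j where "j = (GREATEST j. N j \<le> n)"
  have 1: "N j \<le> n" unfolding j_def by (rule GreatestI_nat[where P="\<lambda>j. N j \<le> n" and b=n, OF n]) (use le in simp)
  have 2: "i \<le> j" if "N i \<le> n" for i
    unfolding j_def by (rule Greatest_le_nat[where P="\<lambda>j. N j \<le> n" and b=n, OF that]) (use le in simp)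
  have "\<not> N (Suc j) \<le> n" using 2[of "Suc j"] by auto
  then show ?thesis using 1 2[OF n] by auto
qed

text \<open>Partial sums of the thresholds are nondecreasing in \<open>j\<close>, so
  \<open>h j\<close> is large enough as a degree and \<open>h (Suc j)\<close> as a damping exponent
  for the same \<open>j\<close>.\<close>

lemma ex_scales:
  fixes \<epsilon> :: "nat \<Rightarrow> real"
  assumes "\<And>j. 0 < \<epsilon> j" "\<And>j. \<epsilon> j \<le> 1"
  shows "\<exists>(h :: nat \<Rightarrow> nat) R. (\<forall>j. 0 < h j) \<and> (\<forall>j. degree (R j) = h j \<and> lead_coeff (R j) = 1) \<and>
    (\<forall>j k t. h (Suc j) \<le> k \<longrightarrow> cmod t = 1 \<longrightarrow> t \<noteq> 1 \<longrightarrow>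
      sqrt (line_weight (Re (cayley t))) * (cmod (slitmap (gap_end j) (cayley t)) ^ h j * cmod (poly (R j) t))
        * cmod (slitmap (gap_end (Suc j)) (cayley t)) ^ k \<le> \<epsilon> j * arc_cap (gap_end j) ^ h j)"
proof -
  have "\<forall>j. \<exists>N. \<forall>m\<ge>N. \<exists>R. degree R = m \<and> lead_coeff R = 1 \<and> (\<forall>k\<ge>N. \<forall>t. cmod t = 1 \<longrightarrow> t \<noteq> 1 \<longrightarrow>
      sqrt (line_weight (Re (cayley t))) * (cmod (slitmap (gap_end j) (cayley t)) ^ m * cmod (poly R t))
        * cmod (slitmap (gap_end (Suc j)) (cayley t)) ^ k \<le> \<epsilon> j * arc_cap (gap_end j) ^ m)"
    using weighted_arc_polynomial gap_end_strict_mono gap_end_step assms by blast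
  then obtain N where N: "\<And>j m. m \<ge> N j \<Longrightarrow> \<exists>R. degree R = m \<and> lead_coeff R = 1 \<and>
      (\<forall>k\<ge>N j. \<forall>t. cmod t = 1 \<longrightarrow> t \<noteq> 1 \<longrightarrow>
      sqrt (line_weight (Re (cayley t))) * (cmod (slitmap (gap_end j) (cayley t)) ^ m * cmod (poly R t))
        * cmod (slitmap (gap_end (Suc j)) (cayley t)) ^ k \<le> \<epsilon> j * arc_cap (gap_end j) ^ m)"
    by metis
  define h where "h j = Suc (\<Sum>i\<le>j. N i)" for j
  have hN: "N i \<le> h j" if "i \<le> j" for i j
    unfolding h_def using that by (intro le_SucI member_le_sum) auto
  have "\<forall>j. \<exists>R. degree R = h j \<and> lead_coeff R = 1 \<and>
      (\<forall>k\<ge>N j. \<forall>t. cmod t = 1 \<longrightarrow> t \<noteq> 1 \<longrightarrow>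
      sqrt (line_weight (Re (cayley t))) * (cmod (slitmap (gap_end j) (cayley t)) ^ h j * cmod (poly R t))
        * cmod (slitmap (gap_end (Suc j)) (cayley t)) ^ k \<le> \<epsilon> j * arc_cap (gap_end j) ^ h j)"
    using N hN by blast
  then obtain R where R: "\<And>j. degree (R j) = h j" "\<And>j. lead_coeff (R j) = 1"
      "\<And>j k t. k \<ge> N j \<Longrightarrow> cmod t = 1 \<Longrightarrow> t \<noteq> 1 \<Longrightarrow>
      sqrt (line_weight (Re (cayley t))) * (cmod (slitmap (gap_end j) (cayley t)) ^ h j * cmod (poly (R j) t))
        * cmod (slitmap (gap_end (Suc j)) (cayley t)) ^ k \<le> \<epsilon> j * arc_cap (gap_end j) ^ h j"
    by metis
  have "0 < h j" for j by (simp add: h_def)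
  moreover have "N j \<le> k" if "h (Suc j) \<le> k" for j k
    using hN[of j "Suc j"] that by simp
  ultimately show ?thesis using R by (intro exI[of _ h] exI[of _ R]) blast
qed

theorem theorem5:
  "\<exists>(\<mu> :: complex measure) (w :: complex \<Rightarrow> real).
     sets \<mu> = sets circle_borel \<and> finite_measure \<mu> \<and>
     absolutely_continuous circle_lebesgue \<mu> \<and>
     w \<in> borel_measurable circle_borel \<and>
     (AE t in circle_lebesgue. 0 < RN_deriv circle_lebesgue \<mu> t \<and> RN_deriv circle_lebesgue \<mu> t < 1) \<and>
     (AE t in circle_lebesgue. 0 < w t \<and> w t \<le> 1) \<and>
     integrable circle_lebesgue (\<lambda>t. ln (w t)) \<and>
     (\<lambda>n. min_monic_norm n (density \<mu> (\<lambda>t. ennreal (w t))) / min_monic_norm n \<mu>) \<longlonglongrightarrow> 0"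
proof -
  define \<kappa> where "\<kappa> j = arc_cap (gap_end j)" for j
  have \<kappa>: "0 < \<kappa> j" "\<kappa> j \<le> 1" for j unfolding \<kappa>_def by (rule arc_cap_pos arc_cap_le_1)+
  \<comment> \<open>\<open>2 ^ (j + 4)\<close> absorbs the factor \<open>2 ^ (j + 2)\<close> of the
    upper bound and the \<open>4\<close> of the lower bound; the capacities absorb the one surplus
    capacity in the lower bound, at level \<open>j\<close> or \<open>Suc j\<close>;
    \<open>real j + 1\<close> makes the ratio tend to \<open>0\<close>.\<close>
  define \<epsilon> where "\<epsilon> j = \<kappa> j * \<kappa> (Suc j) / (2 ^ (j + 4) * (real j + 1))" for j
  have e0: "0 < \<epsilon> j" for j unfolding \<epsilon>_def using \<kappa> by simp
  have e1: "\<epsilon> j \<le> 1" for j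
  proof -
    have "\<kappa> j * \<kappa> (Suc j) \<le> 1 * 1" using \<kappa> by (intro mult_mono) (auto intro: less_imp_le)
    moreover have "1 * 1 \<le> 2 ^ (j + 4) * (real j + 1)" by (intro mult_mono) auto
    ultimately show ?thesis unfolding \<epsilon>_def by (simp add: divide_le_eq_1)
  qed
  obtain h R where h0: "\<And>j. 0 < h j" and R: "\<And>j. degree (R j) = h j" "\<And>j. lead_coeff (R j) = 1"
    and RB: "\<And>j k t. h (Suc j) \<le> k \<Longrightarrow> cmod t = 1 \<Longrightarrow> t \<noteq> 1 \<Longrightarrow>
      sqrt (line_weight (Re (cayley t))) * (cmod (slitmap (gap_end j) (cayley t)) ^ h j * cmod (poly (R j) t))
        * cmod (slitmap (gap_end (Suc j)) (cayley t)) ^ k \<le> \<epsilon> j * arc_cap (gap_end j) ^ h j"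
    using ex_scales[of \<epsilon>, OF e0 e1] by metis
  define w where "w t = line_weight (Re (cayley t))" for t
  define \<mu> where "\<mu> = density circle_lebesgue (\<lambda>t. ennreal (dens h t))"
  interpret prob_space circle_lebesgue by (rule prob_space_circle_lebesgue)
  have dm: "dens h \<in> borel_measurable circle_lebesgue"
    by (rule borel_imp_circle_lebesgue) measurable
  have wtm [measurable]: "line_weight \<in> borel_measurable borel" unfolding line_weight_def[abs_def] by measurable
  have wm: "w \<in> borel_measurable borel" unfolding w_def[abs_def] by measurable
  have AE1: "AE t in circle_lebesgue. cmod t = 1 \<and> t \<noteq> 1"
    using AE_circle_ne_1 AE_space by eventually_elim (simp add: space_circle_lebesgue)
  have w\<mu>: "density \<mu> (\<lambda>t. ennreal (w t)) = density circle_lebesgue (\<lambda>t. ennreal (dens h t * line_weight (Re (cayley t))))"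
  proof -
    have "density \<mu> (\<lambda>t. ennreal (w t)) = density circle_lebesgue (\<lambda>t. ennreal (dens h t) * ennreal (w t))"
      unfolding \<mu>_def using dm borel_imp_circle_lebesgue[OF wm] by (intro density_density_eq) auto
    also have "(\<lambda>t. ennreal (dens h t) * ennreal (w t)) = (\<lambda>t. ennreal (dens h t * line_weight (Re (cayley t))))"
      using dens_bounds(1) by (auto simp: w_def ennreal_mult' )
    finally show ?thesis .
  qed
  have s1: "sets \<mu> = sets circle_borel" by (simp add: \<mu>_def sets_circle_lebesgue)
  have s2: "finite_measure \<mu>"
  proof (rule finite_measureI)
    have "emeasure \<mu> (space \<mu>) = (\<integral>\<^sup>+ t. ennreal (dens h t) \<partial>circle_lebesgue)"
      unfolding \<mu>_def using dm by (subst emeasure_density) (auto intro!: nn_integral_cong)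
    also have "\<dots> \<le> (\<integral>\<^sup>+ t. 1 \<partial>circle_lebesgue)"
      using dens_bounds(2) by (intro nn_integral_mono) (simp add: less_imp_le)
    also have "\<dots> = 1" by (simp add: emeasure_space_1)
    finally show "emeasure \<mu> (space \<mu>) \<noteq> \<infinity>" by (auto simp: top_unique)
  qed
  have s3: "absolutely_continuous circle_lebesgue \<mu>"
    unfolding \<mu>_def using dm by (intro absolutely_continuousI_density) auto
  have s5: "AE t in circle_lebesgue. 0 < RN_deriv circle_lebesgue \<mu> t \<and> RN_deriv circle_lebesgue \<mu> t < 1"
  proof -
    have "AE t in circle_lebesgue. ennreal (dens h t) = RN_deriv circle_lebesgue \<mu> t"
      by (rule RN_deriv_unique) (use dm in \<open>auto simp: \<mu>_def\<close>)
    then show ?thesis using AE1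
    proof eventually_elim
      case (elim t)
      have "0 < dens h t" using slit_density_pos[of t h] dens_eq[of t h] elim by simp
      moreover have "dens h t < 1" by (rule dens_bounds)
      ultimately show ?case unfolding elim(1)[symmetric] by (simp add: ennreal_less_one_iff)
    qed
  qed
  have s6: "AE t in circle_lebesgue. 0 < w t \<and> w t \<le> 1"
    by (intro AE_I2) (simp add: w_def line_weight_pos line_weight_le_1)
  have s7: "integrable circle_lebesgue (\<lambda>t. ln (w t))" unfolding w_def by (rule integrable_log_weight)
  \<comment> \<open>A block starts in the middle of the degrees belonging to arc \<open>j\<close>,
    so that the factor \<open>R j\<close> of degree \<open>h j\<close> fits into the test polynomial
    throughout the block.\<close>
  define N where "N j = (\<Sum>i<j. 2 * h i) + h j" for j
  have N: "N j < N (Suc j)" for j using h0[of j] by (simp add: N_def)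
  define r where "r n = min_monic_norm n (density \<mu> (\<lambda>t. ennreal (w t))) / min_monic_norm n \<mu>" for n
  define K where "K j = (\<Prod>i<j. \<kappa> i ^ (2 * h i))" for j
  have K0: "0 < K j" for j unfolding K_def by (intro prod_pos) (simp add: \<kappa>)
  have lower: "K j * \<kappa> j ^ Suc l / 4 \<le> min_monic_norm ((\<Sum>i<j. 2 * h i) + l) \<mu>" if "l \<le> 2 * h j" for j l
    unfolding K_def \<kappa>_def \<mu>_def using that by (rule min_monic_norm_dens_ge)
  have upper: "min_monic_norm ((\<Sum>i<j. 2 * h i) + h j + a + c) (density \<mu> (\<lambda>t. ennreal (w t)))
      \<le> 2 ^ (j + 2) * \<epsilon> j * (K j * \<kappa> j ^ (h j + a) * \<kappa> (Suc j) ^ c)"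
    if "a \<le> h j" "c \<le> h (Suc j)" for j a c
    unfolding K_def \<kappa>_def w\<mu> using that less_imp_le[OF e0] R RB by (rule min_monic_norm_weighted_le)
  have ratio: "x / y \<le> 1 / (real j + 1)"
    if "x \<le> 2 ^ (j + 2) * \<epsilon> j * B" "B * k / 4 \<le> y" "0 < B" "0 < k" "\<kappa> j * \<kappa> (Suc j) \<le> k" for x y B k j
  proof -
    have y0: "0 < y" using that by (smt (verit) divide_pos_pos mult_pos_pos)
    have "2 ^ (j + 2) * \<epsilon> j = \<kappa> j * \<kappa> (Suc j) / 4 / (real j + 1)"
    proof -
      have "2 ^ (j + 2) * (A / (2 ^ (j + 4) * d)) = A / 4 / d" if "0 < d" for A d :: real
        using that by (simp add: power_add field_simps)
      then show ?thesis unfolding \<epsilon>_def by simp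
    qed
    then have "x \<le> (\<kappa> j * \<kappa> (Suc j) / 4 / (real j + 1)) * B" using that(1) by simp
    also have "\<dots> \<le> (k / 4 / (real j + 1)) * B"
      using that by (intro mult_right_mono divide_right_mono) auto
    also have "\<dots> = (B * k / 4) / (real j + 1)" by simp
    also have "\<dots> \<le> y / (real j + 1)" using that(2) by (intro divide_right_mono) auto
    finally show ?thesis using y0 by (simp add: field_simps)
  qed
  have level: "r n \<le> 1 / (real j + 1)" if n: "N j \<le> n" "n < N (Suc j)" for n j
  \<comment> \<open>The block from \<open>N j\<close> to \<open>N (Suc j)\<close> is split where the
    degree \<open>2 * h j\<close> of arc \<open>j\<close> is exhausted; beyond it the lower bound
    for level \<open>Suc j\<close> applies, while the test polynomial still uses
    \<open>R j\<close>.\<close>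
  proof (cases "n \<le> N j + h j")
    case True
    define a where "a = n - N j"
    have a: "a \<le> h j" using True by (simp add: a_def)
    have n1: "n = (\<Sum>i<j. 2 * h i) + h j + a + 0" using n by (simp add: a_def N_def)
    have n2: "n = (\<Sum>i<j. 2 * h i) + (h j + a)" using n1 by simp
    show ?thesis unfolding r_def
    proof (rule ratio)
      show "min_monic_norm n (density \<mu> (\<lambda>t. ennreal (w t))) \<le> 2 ^ (j + 2) * \<epsilon> j * (K j * \<kappa> j ^ (h j + a))"
        using upper[OF a, of 0] unfolding n1[symmetric] by simp
      show "K j * \<kappa> j ^ (h j + a) * \<kappa> j / 4 \<le> min_monic_norm n \<mu>"
        using lower[of "h j + a" j] a unfolding n2[symmetric] by (simp add: mult_ac)
      show "\<kappa> j * \<kappa> (Suc j) \<le> \<kappa> j" using \<kappa>[of j] \<kappa>[of "Suc j"] by (intro mult_left_le) auto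
    qed (use K0 \<kappa> in simp_all)
  next
    case False
    define c where "c = n - (N j + h j)"
    have c: "c \<le> h (Suc j)" using False n by (simp add: c_def N_def)
    have n1: "n = (\<Sum>i<j. 2 * h i) + h j + h j + c" using False by (simp add: c_def N_def)
    have n2: "n = (\<Sum>i<Suc j. 2 * h i) + c" using n1 by simp
    show ?thesis unfolding r_def
    proof (rule ratio)
      show "min_monic_norm n (density \<mu> (\<lambda>t. ennreal (w t)))
          \<le> 2 ^ (j + 2) * \<epsilon> j * (K (Suc j) * \<kappa> (Suc j) ^ c)"
      proof -
        have KS: "K (Suc j) = K j * \<kappa> j ^ (h j + h j)" by (simp add: K_def mult_2[symmetric])
        show ?thesis using upper[OF order_refl c] unfolding n1[symmetric] KS .
      qed
      show "K (Suc j) * \<kappa> (Suc j) ^ c * \<kappa> (Suc j) / 4 \<le> min_monic_norm n \<mu>"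
        using lower[of c "Suc j"] c unfolding n2[symmetric] by (simp add: mult_ac)
      show "\<kappa> j * \<kappa> (Suc j) \<le> \<kappa> (Suc j)"
        using \<kappa>[of j] \<kappa>[of "Suc j"] by (intro mult_left_le_one_le) auto
    qed (use K0 \<kappa> in simp_all)
  qed
  have r0: "0 \<le> r n" for n unfolding r_def by (intro divide_nonneg_nonneg min_monic_norm_nonneg)
  have s8: "r \<longlonglongrightarrow> 0"
  proof (rule LIMSEQ_I)
    fix e :: real assume "0 < e"
    then obtain J where J: "inverse (real (Suc J)) < e" using reals_Archimedean by blast
    have "norm (r n - 0) < e" if nJ: "N J \<le> n" for n
    proof -
      obtain j where j: "J \<le> j" "N j \<le> n" "n < N (Suc j)" using ex_level[OF N nJ] by blast
      have "r n \<le> 1 / (real j + 1)" using level j by blast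
      also have "\<dots> \<le> 1 / (real J + 1)" using j(1) by (intro divide_left_mono) auto
      also have "\<dots> < e" using J by (simp add: inverse_eq_divide add.commute)
      finally show ?thesis using r0[of n] by simp
    qed
    then show "\<exists>no. \<forall>n\<ge>no. norm (r n - 0) < e" by blast
  qed
  show ?thesis
    by (rule exI[of _ \<mu>], rule exI[of _ w])
       (use s1 s2 s3 borel_imp_circle[OF wm] s5 s6 s7 s8[unfolded r_def] in blast)
qed

end
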